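(* Let $0\le m\le n$ be integers and let $K_m(x,y)$ be the multivariable Christoffel--Darboux kernel associated with the given linear functional, written as $K_m(z)=K_m(z_1,\dots,z_{2m})$ with $(z_1,\dots,z_{2m})=(x_1,\dots,x_m,y_1,\dots,y_m)$. Then, for any choice of square roots $\sqrt{z_i}$ (such that the denominator below does not vanish), $$K_m(z)=\frac{1}{\prod_{1\le i<j\le 2m}(\sqrt{z_j}-\sqrt{z_i})}\;\operatorname{pfaff}_{1\le i,j\le 2m}\left((\sqrt{z_j}-\sqrt{z_i})\,K(z_i,z_j)\right).$$ Moreover, for any choice of $\zeta_1,\dots,\zeta_{2m}$ such that $\zeta_i+\zeta_i^{-1}=z_i+2$ for all $i$ (and such that the denominator below does not vanish), $$K_m(z)=\frac{\prod_{i=1}^{2m}\zeta_i^{m-1}}{\prod_{1\le i<j\le 2m}(\zeta_j-\zeta_i)}\;\operatorname{pfaff}_{1\le i,j\le 2m}\left((\zeta_j-\zeta_i)\,K(z_i,z_j)\right).$$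
   Context: Scalars are complex. Let $f\mapsto\int f(x)\,d\mu(x)$ be a linear functional on polynomials in one variable. For $n\ge1$ let $V_n$ be the space of one-variable polynomials of degree at most $n-1$, and assume that the bilinear pairing $\langle f,g\rangle=\int f(x)g(x)\,d\mu(x)$ is non-degenerate on each $V_n$. Let $(p_k)_{k\ge0}$ be the corresponding monic orthogonal polynomials ($\deg p_k=k$). Let $K(x,y)=\sum_{k=0}^{n-1}\frac{p_k(x)p_k(y)}{\langle p_k,p_k\rangle}$ (depending on $n$). For $x=(x_1,\dots,x_m)$ put $\Delta(x)=\prod_{1\le i<j\le m}(x_j-x_i)$. Let $V_n^m$ ($0\le m\le n$) be the space of antisymmetric polynomials in $x_1,\dots,x_m$ of degree at most $n-1$ in each $x_i$. Write $\int f(x)\,d\mu_m(x)=\frac1{m!}\int f(x_1,\dots,x_m)\,d\mu(x_1)\cdots d\mu(x_m)$, where the functional is applied in each variable separately. The kernel $K_m(x,y)$ is defined by requiring that $\Delta(x)\Delta(y)K_m(x,y)$ be the reproducing kernel of $V_n^m$, i.e. the unique element of $V_n^m\otimes V_n^m$ such that $f(x)=\int f(y)\Delta(x)\Delta(y)K_m(x,y)\,d\mu_m(y)$ for all $f\in V_n^m$. Equivalently, $K_m(x,y)=\frac{\det_{1\le i,j\le m}(K(x_i,y_j))}{\Delta(x)\Delta(y)}$, which is a polynomial. Empty products and determinants equal $1$. The Pfaffian of a skew-symmetric $2m\times2m$ matrix is $\operatorname{pfaff}_{1\le i,j\le 2m}(a_{ij})=\frac{1}{2^mm!}\sum_{\sigma\in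 S_{2m}}\operatorname{sgn}(\sigma)\prod_{i=1}^m a_{\sigma(2i-1),\sigma(2i)}$. *)

theory Defs
  imports
    Complex_Main
    "HOL-Library.FuncSet"
    "HOL-Combinatorics.Permutations"
    "HOL-Computational_Algebra.Polynomial"
begin

text \<open>
  The functional \<open>f \<mapsto> \<integral>f d\<mu>\<close> is a function \<open>L\<close> on univariate polynomials. Tuples of variables
  are functions on \<open>nat\<close>, indexed from \<open>0\<close>; only finitely many initial coordinates matter.
  Polynomials in several variables are represented by the functions they induce, which loses
  nothing over the complex numbers.
\<close>

definition pairing :: "(complex poly \<Rightarrow> complex) \<Rightarrow> complex poly \<Rightarrow> complex poly \<Rightarrow> complex" where
  "pairing L f g = L (f * g)"

definition polys_less :: "nat \<Rightarrow> complex poly set" where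
  "polys_less n = {f. f = 0 \<or> degree f < n}"

definition nondegenerate_on :: "(complex poly \<Rightarrow> complex) \<Rightarrow> complex poly set \<Rightarrow> bool" where
  "nondegenerate_on L V \<longleftrightarrow> (\<forall>f\<in>V. (\<forall>g\<in>V. pairing L f g = 0) \<longrightarrow> f = 0)"

definition orth_polys :: "(complex poly \<Rightarrow> complex) \<Rightarrow> nat \<Rightarrow> complex poly" where
  "orth_polys L = (THE p. (\<forall>k. degree (p k) = k \<and> lead_coeff (p k) = 1) \<and>
                          (\<forall>j k. j \<noteq> k \<longrightarrow> pairing L (p j) (p k) = 0))"

definition cd_kernel :: "(complex poly \<Rightarrow> complex) \<Rightarrow> nat \<Rightarrow> complex \<Rightarrow> complex \<Rightarrow> complex" where
  "cd_kernel L n x y =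
     (\<Sum>k<n. poly (orth_polys L k) x * poly (orth_polys L k) y
              / pairing L (orth_polys L k) (orth_polys L k))"

definition vandermonde :: "nat \<Rightarrow> (nat \<Rightarrow> complex) \<Rightarrow> complex" where
  "vandermonde m x = (\<Prod>j<m. \<Prod>i<j. x j - x i)"

text \<open>Polynomials in the first \<open>m\<close> variables, of degree less than \<open>n\<close> in each of them.\<close>

definition mpolys_less :: "nat \<Rightarrow> nat \<Rightarrow> ((nat \<Rightarrow> complex) \<Rightarrow> complex) set" where
  "mpolys_less m n =
     {f. \<exists>c. f = (\<lambda>x. \<Sum>e\<in>{..<m} \<rightarrow>\<^sub>E {..<n}. c e * (\<Prod>i<m. x i ^ e i))}"

definition mpolys :: "nat \<Rightarrow> ((nat \<Rightarrow> complex) \<Rightarrow> complex) set" where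
  "mpolys m = (\<Union>n. mpolys_less m n)"

definition antisym_polys :: "nat \<Rightarrow> nat \<Rightarrow> ((nat \<Rightarrow> complex) \<Rightarrow> complex) set" where
  "antisym_polys m n =
     {f \<in> mpolys_less m n. \<forall>\<sigma> x. \<sigma> permutes {..<m} \<longrightarrow> f (x \<circ> \<sigma>) = of_int (sign \<sigma>) * f x}"

text \<open>Applying the functional in the variable \<open>x\<^sub>i\<close>, the other variables being kept as parameters.\<close>

definition integrate_var ::
  "(complex poly \<Rightarrow> complex) \<Rightarrow> nat \<Rightarrow> ((nat \<Rightarrow> complex) \<Rightarrow> complex) \<Rightarrow> (nat \<Rightarrow> complex) \<Rightarrow> complex" where
  "integrate_var L i f x = L (THE q. \<forall>t. poly q t = f (x(i := t)))"

text \<open>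
  The evaluation at \<open>0\<close> in the first equation is immaterial for polynomials in the first \<open>m\<close>
  variables, since nothing depends on the point once these have been integrated out.
\<close>

primrec iterated_integral ::
  "(complex poly \<Rightarrow> complex) \<Rightarrow> nat \<Rightarrow> ((nat \<Rightarrow> complex) \<Rightarrow> complex) \<Rightarrow> complex" where
  "iterated_integral L 0 f = f (\<lambda>_. 0)"
| "iterated_integral L (Suc m) f = iterated_integral L m (integrate_var L m f)"

definition mu_integral ::
  "(complex poly \<Rightarrow> complex) \<Rightarrow> nat \<Rightarrow> ((nat \<Rightarrow> complex) \<Rightarrow> complex) \<Rightarrow> complex" where
  "mu_integral L m f = iterated_integral L m f / fact m"

definition tensor_square ::
  "((nat \<Rightarrow> complex) \<Rightarrow> complex) set \<Rightarrow> ((nat \<Rightarrow> complex) \<Rightarrow> (nat \<Rightarrow> complex) \<Rightarrow> complex) set" where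
  "tensor_square V =
     {G. \<exists>(N::nat) f g. (\<forall>i<N. f i \<in> V \<and> g i \<in> V) \<and> G = (\<lambda>x y. \<Sum>i<N. f i x * g i y)}"

definition reproducing_kernel ::
  "(complex poly \<Rightarrow> complex) \<Rightarrow> nat \<Rightarrow> nat \<Rightarrow> (nat \<Rightarrow> complex) \<Rightarrow> (nat \<Rightarrow> complex) \<Rightarrow> complex" where
  "reproducing_kernel L n m =
     (THE G. G \<in> tensor_square (antisym_polys m n) \<and>
             (\<forall>f\<in>antisym_polys m n. \<forall>x. f x = mu_integral L m (\<lambda>y. f y * G x y)))"

text \<open>
  The multivariable kernel is a polynomial in \<open>z = (x, y)\<close>, where \<open>x\<close> consists of the first \<open>m\<close>
  coordinates of \<open>z\<close> and \<open>y\<close> of the following \<open>m\<close>. Characterizing it as a polynomial, rather than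
  as a quotient, determines its values where \<open>\<Delta>(x) \<Delta>(y) = 0\<close> too.
\<close>

definition mcd_kernel ::
  "(complex poly \<Rightarrow> complex) \<Rightarrow> nat \<Rightarrow> nat \<Rightarrow> (nat \<Rightarrow> complex) \<Rightarrow> complex" where
  "mcd_kernel L n m =
     (THE k. k \<in> mpolys (2 * m) \<and>
             (\<forall>z. vandermonde m z * vandermonde m (\<lambda>i. z (m + i)) * k z
                  = reproducing_kernel L n m z (\<lambda>i. z (m + i))))"

text \<open>The Pfaffian of the \<open>2m \<times> 2m\<close> matrix with entries \<open>a i j\<close> for \<open>i, j < 2m\<close>.\<close>

definition pfaffian :: "nat \<Rightarrow> (nat \<Rightarrow> nat \<Rightarrow> complex) \<Rightarrow> complex" where
  "pfaffian m a =
     1 / (2 ^ m * fact m) *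
     (\<Sum>\<sigma> | \<sigma> permutes {..<2 * m}. of_int (sign \<sigma>) * (\<Prod>i<m. a (\<sigma> (2 * i)) (\<sigma> (2 * i + 1))))"

end

theory Submission
  imports "Jordan_Normal_Form.Determinant" Defs
begin

text \<open>
  The kernel \<open>K\<^sub>m\<close> is a symmetric function of all its \<open>2 m\<close> variables, although its definition treats
  the two halves differently (\<open>mcd_kernel_symmetric\<close>). Granted this, both formulas are a Laplace
  expansion of a Vandermonde determinant (\<open>pfaffian_formula\<close>). Let numbers \<open>a\<^sub>i\<close>, \<open>b\<^sub>i\<close>, \<open>c\<^sub>i\<close> satisfy
  \<open>a\<^sub>i\<^sup>2 b\<^sub>j\<^sup>2 - a\<^sub>j\<^sup>2 b\<^sub>i\<^sup>2 = c\<^sub>i c\<^sub>j (z\<^sub>j - z\<^sub>i)\<close>, and expand the Pfaffian of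
  \<open>(a\<^sub>i b\<^sub>j - a\<^sub>j b\<^sub>i) K(z\<^sub>i, z\<^sub>j)\<close> by linearity in \<open>a\<close> and \<open>b\<close>. The terms in which the \<open>m\<close> indices in a set
  \<open>S\<close> contribute a factor \<open>a\<close>, and the others a factor \<open>b\<close>, make up the determinant of \<open>K\<close> with
  rows indexed by \<open>S\<close> and columns by the complement. By symmetry this is \<open>K\<^sub>m(z)\<close> times the two
  Vandermonde products of the \<open>z\<^sub>i\<close> with \<open>i\<close> in \<open>S\<close> and of those with \<open>i\<close> in the complement, and by assumption
  these are, up to the \<open>c\<^sub>i\<close>, Vandermonde products of the points \<open>(a\<^sub>i\<^sup>2 : b\<^sub>i\<^sup>2)\<close> of the projective line.
  The sum over all \<open>S\<close> is the Laplace expansion of the Vandermonde determinant of the \<open>2 m\<close> points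
  \<open>(a\<^sub>i : b\<^sub>i)\<close> along the even and the odd powers of \<open>b\<close>.

  The first formula is the case \<open>a = 1\<close>, \<open>b = \<surd>z\<close>, \<open>c = 1\<close>. The second one is \<open>a = (\<zeta> + 1) / 2\<close>,
  \<open>b = \<zeta> - 1\<close>, \<open>c = \<zeta>\<close>: since \<open>(\<zeta> - 1)\<^sup>2 = \<zeta> z\<close> and \<open>(\<zeta> + 1)\<^sup>2 = \<zeta> (z + 4)\<close>, the ratio \<open>b / a\<close> is a square
  root of a Moebius transform of \<open>z\<close>. Homogeneous coordinates admit the value \<open>\<zeta> = -1\<close>, where \<open>a\<close> vanishes.

  For the symmetry, only the exchange of a variable \<open>x\<close> in the first half with a variable \<open>y\<close> in the
  second is not obvious from \<open>det K(x\<^sub>i, y\<^sub>j) / (\<Delta>(x) \<Delta>(y))\<close>. Condensing the determinant with pivot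
  \<open>K(x, y)\<close> (\<open>fun_det_condensation\<close>) reduces it to \<open>m = 2\<close>, where it amounts to a Pluecker relation
  by the Christoffel--Darboux formula (\<open>K_exchange\<close>).

  The divisions by Vandermonde products and by the pivot are legitimate at generic points, and identities
  of polynomials extend from there to all points (\<open>mpolys_eqI_generic\<close>).
\<close>

section \<open>Polynomial functions of several variables\<close>

lemma mpolys_less_monomial_sumI:
  assumes "finite S" "\<And>s i. s \<in> S \<Longrightarrow> i < m \<Longrightarrow> e s i < n"
  shows "(\<lambda>x. \<Sum>s\<in>S. c s * (\<Prod>i<m. x i ^ e s i)) \<in> mpolys_less m n"
proof -
  define r where "r s = restrict (e s) {..<m}" for s
  define c' where "c' d = (\<Sum>s | s \<in> S \<and> r s = d. c s)" for d
  have r: "r ` S \<subseteq> {..<m} \<rightarrow>\<^sub>E {..<n}"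
    using assms(2) by (auto simp: r_def PiE_iff extensional_def split: if_splits)
  have "(\<Sum>s\<in>S. c s * (\<Prod>i<m. x i ^ e s i))
      = (\<Sum>d\<in>{..<m} \<rightarrow>\<^sub>E {..<n}. c' d * (\<Prod>i<m. x i ^ d i))" for x :: "nat \<Rightarrow> complex"
  proof -
    have "(\<Sum>s\<in>S. c s * (\<Prod>i<m. x i ^ e s i))
        = (\<Sum>d\<in>{..<m} \<rightarrow>\<^sub>E {..<n}. \<Sum>s | s \<in> S \<and> r s = d. c s * (\<Prod>i<m. x i ^ e s i))"
      by (rule sum.group[OF assms(1) _ r, symmetric]) (simp add: finite_PiE)
    also have "\<dots> = (\<Sum>d\<in>{..<m} \<rightarrow>\<^sub>E {..<n}. \<Sum>s | s \<in> S \<and> r s = d. c s * (\<Prod>i<m. x i ^ d i))"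
      by (intro sum.cong arg_cong2[of _ _ _ _ "(*)"] prod.cong refl) (auto simp: r_def)
    finally show ?thesis by (simp add: c'_def sum_distrib_right)
  qed
  then show ?thesis unfolding mpolys_less_def by blast
qed

lemma mpolys_less_mono: "mpolys_less m n \<subseteq> mpolys_less m n'" if "n \<le> n'"
proof
  fix f assume "f \<in> mpolys_less m n"
  then obtain c where "f = (\<lambda>x. \<Sum>e\<in>{..<m} \<rightarrow>\<^sub>E {..<n}. c e * (\<Prod>i<m. x i ^ e i))"
    by (auto simp: mpolys_less_def)
  then show "f \<in> mpolys_less m n'"
    using mpolys_less_monomial_sumI[of "{..<m} \<rightarrow>\<^sub>E {..<n}" m "\<lambda>e. e" n' c] that
    by (force simp: finite_PiE PiE_iff)
qed

lemma mpolys_less_add: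
  assumes "f \<in> mpolys_less m n" "g \<in> mpolys_less m n"
  shows "(\<lambda>x. f x + g x) \<in> mpolys_less m n"
proof -
  obtain c d where
    "f = (\<lambda>x. \<Sum>e\<in>{..<m} \<rightarrow>\<^sub>E {..<n}. c e * (\<Prod>i<m. x i ^ e i))"
    "g = (\<lambda>x. \<Sum>e\<in>{..<m} \<rightarrow>\<^sub>E {..<n}. d e * (\<Prod>i<m. x i ^ e i))"
    using assms by (auto simp: mpolys_less_def)
  then have "(\<lambda>x. f x + g x)
      = (\<lambda>x. \<Sum>e\<in>{..<m} \<rightarrow>\<^sub>E {..<n}. (c e + d e) * (\<Prod>i<m. x i ^ e i))"
    by (simp add: sum.distrib distrib_right)
  then show ?thesis unfolding mpolys_less_def by (intro CollectI exI)
qed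

lemma mpolys_less_cmult:
  assumes "f \<in> mpolys_less m n"
  shows "(\<lambda>x. a * f x) \<in> mpolys_less m n"
proof -
  obtain c where "f = (\<lambda>x. \<Sum>e\<in>{..<m} \<rightarrow>\<^sub>E {..<n}. c e * (\<Prod>i<m. x i ^ e i))"
    using assms by (auto simp: mpolys_less_def)
  then have "(\<lambda>x. a * f x)
      = (\<lambda>x. \<Sum>e\<in>{..<m} \<rightarrow>\<^sub>E {..<n}. (a * c e) * (\<Prod>i<m. x i ^ e i))"
    by (simp add: sum_distrib_left mult.assoc)
  then show ?thesis unfolding mpolys_less_def by (intro CollectI exI)
qed

lemma mpolys_less_zero: "(\<lambda>x. 0) \<in> mpolys_less m n"
  using mpolys_less_monomial_sumI[of "{}"] by simp

lemma mpolys_less_sum: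
  "(\<And>s. s \<in> S \<Longrightarrow> f s \<in> mpolys_less m n) \<Longrightarrow> (\<lambda>x. \<Sum>s\<in>S. f s x) \<in> mpolys_less m n"
  by (induction S rule: infinite_finite_induct)
     (auto intro!: mpolys_less_add mpolys_less_zero)

lemma mpolys_less_prod_poly:
  assumes "\<And>i. i < m \<Longrightarrow> degree (q i) < n"
  shows "(\<lambda>x. \<Prod>i<m. poly (q i) (x i)) \<in> mpolys_less m n"
proof -
  have "poly (q i) t = (\<Sum>k<n. coeff (q i) k * t ^ k)" if "i < m" for i t
    unfolding poly_altdef using assms[OF that]
    by (intro sum.mono_neutral_left) (auto simp: coeff_eq_0)
  then have "(\<lambda>x. \<Prod>i<m. poly (q i) (x i))
      = (\<lambda>x. \<Sum>e\<in>{..<m} \<rightarrow>\<^sub>E {..<n}. (\<Prod>i<m. coeff (q i) (e i)) * (\<Prod>i<m. x i ^ e i))"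
    by (simp add: prod_sum_PiE prod.distrib)
  then show ?thesis unfolding mpolys_less_def by (intro CollectI exI)
qed

lemma mpolys_const: "(\<lambda>x. c) \<in> mpolys m"
  using mpolys_less_monomial_sumI[of "{()}" m "\<lambda>_ _. 0" 1 "\<lambda>_. c"] by (auto simp: mpolys_def)

lemma mpolys_var:
  assumes "k < m"
  shows "(\<lambda>x. x k) \<in> mpolys m"
proof -
  have "(\<Prod>i<m. x i ^ (if i = k then 1 else 0)) = x k" for x :: "nat \<Rightarrow> complex"
    using assms by (subst prod.mono_neutral_right[of _ "{k}"]) auto
  then show ?thesis
    using mpolys_less_monomial_sumI[of "{()}" m "\<lambda>_ i. if i = k then 1 else 0" 2 "\<lambda>_. 1"]
    by (auto simp: mpolys_def intro: exI[of _ 2])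
qed

lemma mpolys_add:
  assumes "f \<in> mpolys m" "g \<in> mpolys m"
  shows "(\<lambda>x. f x + g x) \<in> mpolys m"
proof -
  obtain n n' where "f \<in> mpolys_less m n" "g \<in> mpolys_less m n'"
    using assms by (auto simp: mpolys_def)
  then have "f \<in> mpolys_less m (max n n')" "g \<in> mpolys_less m (max n n')"
    using mpolys_less_mono[of _ "max n n'" m] by (meson max.cobounded1 max.cobounded2 subsetD)+
  then show ?thesis using mpolys_less_add by (force simp: mpolys_def)
qed

lemma mpolys_mult:
  assumes "f \<in> mpolys m" "g \<in> mpolys m"
  shows "(\<lambda>x. f x * g x) \<in> mpolys m"
proof -
  obtain n n' c d where fg:
    "f = (\<lambda>x. \<Sum>e\<in>{..<m} \<rightarrow>\<^sub>E {..<n}. c e * (\<Prod>i<m. x i ^ e i))"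
    "g = (\<lambda>x. \<Sum>e\<in>{..<m} \<rightarrow>\<^sub>E {..<n'}. d e * (\<Prod>i<m. x i ^ e i))"
    using assms by (auto simp: mpolys_def mpolys_less_def)
  let ?S = "({..<m} \<rightarrow>\<^sub>E {..<n}) \<times> ({..<m} \<rightarrow>\<^sub>E {..<n'})"
  have "(\<lambda>x. f x * g x) = (\<lambda>x. \<Sum>s\<in>?S.
      (c (fst s) * d (snd s)) * (\<Prod>i<m. x i ^ (fst s i + snd s i)))"
    unfolding fg sum_product sum.cartesian_product
    by (simp add: case_prod_beta power_add prod.distrib mult_ac)
  also have "\<dots> \<in> mpolys_less m (n + n')"
    by (rule mpolys_less_monomial_sumI)
       (fastforce simp: finite_PiE PiE_iff intro: add_strict_mono)+
  finally show ?thesis by (auto simp: mpolys_def)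
qed

lemma mpolys_diff: "f \<in> mpolys m \<Longrightarrow> g \<in> mpolys m \<Longrightarrow> (\<lambda>x. f x - g x) \<in> mpolys m"
  using mpolys_add[of f m "\<lambda>x. (-1) * g x"] mpolys_mult[OF mpolys_const[of "-1"], of g] by simp

lemma mpolys_sum: "(\<And>s. s \<in> S \<Longrightarrow> f s \<in> mpolys m) \<Longrightarrow> (\<lambda>x. \<Sum>s\<in>S. f s x) \<in> mpolys m"
  by (induction S rule: infinite_finite_induct) (auto intro!: mpolys_add mpolys_const)

lemma mpolys_prod: "(\<And>s. s \<in> S \<Longrightarrow> f s \<in> mpolys m) \<Longrightarrow> (\<lambda>x. \<Prod>s\<in>S. f s x) \<in> mpolys m"
  by (induction S rule: infinite_finite_induct) (auto intro!: mpolys_mult mpolys_const)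

lemma mpolys_power: "f \<in> mpolys m \<Longrightarrow> (\<lambda>x. f x ^ k) \<in> mpolys m"
  by (induction k) (auto intro: mpolys_mult mpolys_const)

lemmas mpolys_intros =
  mpolys_const mpolys_var mpolys_add mpolys_mult mpolys_diff mpolys_sum mpolys_prod mpolys_power

lemma mpolys_poly: "f \<in> mpolys m \<Longrightarrow> (\<lambda>x. poly p (f x)) \<in> mpolys m"
  unfolding poly_altdef by (intro mpolys_intros)

text \<open>
  Conversely, constants and variables generate all polynomial functions under sums and products, so
  that their properties can be proved by structural induction, without reference to exponents.
\<close>

lemma mpolys_induct [consumes 1, case_names const var add mult]:
  assumes "f \<in> mpolys m"
    and const: "\<And>c. P (\<lambda>x. c)"
    and var: "\<And>i. i < m \<Longrightarrow> P (\<lambda>x. x i)"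
    and add: "\<And>f g. f \<in> mpolys m \<Longrightarrow> g \<in> mpolys m \<Longrightarrow> P f \<Longrightarrow> P g \<Longrightarrow> P (\<lambda>x. f x + g x)"
    and mult: "\<And>f g. f \<in> mpolys m \<Longrightarrow> g \<in> mpolys m \<Longrightarrow> P f \<Longrightarrow> P g \<Longrightarrow> P (\<lambda>x. f x * g x)"
  shows "P f"
proof -
  define Q where "Q f \<longleftrightarrow> f \<in> mpolys m \<and> P f" for f
  have Q: "Q (\<lambda>x. c)" "i < m \<Longrightarrow> Q (\<lambda>x. x i)" "Q f \<Longrightarrow> Q g \<Longrightarrow> Q (\<lambda>x. f x + g x)"
    "Q f \<Longrightarrow> Q g \<Longrightarrow> Q (\<lambda>x. f x * g x)" for c i f g
    unfolding Q_def by (auto intro: mpolys_intros assms)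
  have pow: "Q (\<lambda>x. x i ^ k)" if "i < m" for i k
    by (induction k) (auto intro!: Q that)
  have prod: "Q (\<lambda>x. \<Prod>i<k. x i ^ e i)" if "k \<le> m" for e k
    using that by (induction k) (auto intro!: Q pow)
  have sum: "Q (\<lambda>x. \<Sum>s\<in>S. c s * (\<Prod>i<m. x i ^ s i))" for S and c :: "(nat \<Rightarrow> nat) \<Rightarrow> complex"
    by (induction S rule: infinite_finite_induct) (auto intro!: Q prod)
  show ?thesis
    using assms(1) sum unfolding Q_def mpolys_def mpolys_less_def by fastforce
qed


lemma mpolys_subst:
  assumes "f \<in> mpolys m" "\<And>i. i < m \<Longrightarrow> g i \<in> mpolys m'"
  shows "(\<lambda>x. f (\<lambda>i. g i x)) \<in> mpolys m'"
  using assms(1)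
  by (induction rule: mpolys_induct) (auto intro: mpolys_intros assms(2))

lemma mpolys_fun_upd_var:
  assumes "f \<in> mpolys m" "i < m"
  shows "(\<lambda>x. f (x(j := x i))) \<in> mpolys m"
proof -
  have "(\<lambda>x. if k = j then x i else x k) \<in> mpolys m" if "k < m" for k
    using assms(2) that by (cases "k = j") (auto intro: mpolys_var)
  from mpolys_subst[OF assms(1) this] show ?thesis
    by (simp add: fun_upd_def)
qed

lemma mpolys_on_line:
  assumes "f \<in> mpolys m"
  shows "\<exists>p. \<forall>t. poly p t = f (\<lambda>i. x i + t * d i)"
  using assms
proof (induction rule: mpolys_induct)
  case (const c)
  show ?case by (rule exI[of _ "[:c:]"]) simp
next
  case (var i)
  show ?case by (rule exI[of _ "[:x i, d i:]"]) simp
next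
  case (add f g)
  then show ?case by (metis poly_add)
next
  case (mult f g)
  then show ?case by (metis poly_mult)
qed

text \<open>
  Polynomial functions form an integral domain: on the line joining an arbitrary point to one where
  \<open>h\<close> does not vanish, \<open>f\<close> and \<open>h\<close> restrict to univariate polynomials with product \<open>0\<close>. This is
  how identities established at generic points are extended to all points below.
\<close>

lemma mpolys_mult_eq_0:
  assumes "f \<in> mpolys m" "h \<in> mpolys m" "\<And>x. f x * h x = 0" "h x0 \<noteq> 0"
  shows "f x = 0"
proof -
  obtain p where p: "\<And>t. poly p t = f (\<lambda>i. x i + t * (x0 i - x i))"
    using mpolys_on_line[OF assms(1)] by metis
  obtain q where q: "\<And>t. poly q t = h (\<lambda>i. x i + t * (x0 i - x i))"
    using mpolys_on_line[OF assms(2)] by metis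
  have "poly (p * q) t = 0" for t by (simp add: p q assms(3))
  then have "p * q = 0" using poly_all_0_iff_0 by blast
  moreover have "q \<noteq> 0" using q[of 1] assms(4) by auto
  ultimately have "p = 0" by simp
  then show ?thesis using p[of 0] by simp
qed

lemma mpolys_eqI_generic:
  assumes "f \<in> mpolys m" "g \<in> mpolys m" "h \<in> mpolys m"
    and "\<And>x. h x \<noteq> 0 \<Longrightarrow> f x = g x" "h x0 \<noteq> 0"
  shows "f = g"
proof
  fix x
  have "(\<lambda>x. f x - g x) x = 0"
    by (rule mpolys_mult_eq_0[of _ m h x0]) (use assms in \<open>auto intro: mpolys_diff\<close>)
  then show "f x = g x" by simp
qed

text \<open>
  The factor theorem: a polynomial function that vanishes where \<open>x i = x j\<close> is divisible by
  \<open>x j - x i\<close>.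
\<close>

lemma mpolys_diff_diagonal:
  assumes "f \<in> mpolys m" "i < m" "j < m"
  shows "\<exists>g\<in>mpolys m. \<forall>x. f x - f (x(j := x i)) = (x j - x i) * g x"
  using assms(1)
proof (induction rule: mpolys_induct)
  case (const c)
  show ?case by (rule bexI[of _ "\<lambda>_. 0"]) (auto intro: mpolys_const)
next
  case (var k)
  show ?case
    by (rule bexI[of _ "\<lambda>_. if k = j then 1 else 0"]) (auto intro: mpolys_const)
next
  case (add f g)
  then obtain f' g' where "f' \<in> mpolys m" "g' \<in> mpolys m"
    and "\<And>x. f x - f (x(j := x i)) = (x j - x i) * f' x"
    and "\<And>x. g x - g (x(j := x i)) = (x j - x i) * g' x" by blast
  moreover have "f x + g x - (f (x(j := x i)) + g (x(j := x i)))
      = (f x - f (x(j := x i))) + (g x - g (x(j := x i)))" for x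
    by simp
  ultimately have "f x + g x - (f (x(j := x i)) + g (x(j := x i))) = (x j - x i) * (f' x + g' x)"
    for x by (simp only: distrib_left)
  then show ?case
    by (intro bexI[of _ "\<lambda>x. f' x + g' x"] allI mpolys_add \<open>f' \<in> mpolys m\<close> \<open>g' \<in> mpolys m\<close>)
next
  case (mult f g)
  then obtain f' g' where fg: "f' \<in> mpolys m" "g' \<in> mpolys m"
    and f': "\<And>x. f x - f (x(j := x i)) = (x j - x i) * f' x"
    and g': "\<And>x. g x - g (x(j := x i)) = (x j - x i) * g' x" by blast
  have eq: "f x * g x - f (x(j := x i)) * g (x(j := x i))
      = (x j - x i) * (f' x * g x + f (x(j := x i)) * g' x)" for x
  proof -
    have "f x * g x - f (x(j := x i)) * g (x(j := x i))
        = (f x - f (x(j := x i))) * g x + f (x(j := x i)) * (g x - g (x(j := x i)))"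
      by (simp add: algebra_simps)
    then show ?thesis by (simp add: f' g' algebra_simps)
  qed
  show ?case
    by (intro bexI[of _ "\<lambda>x. f' x * g x + f (x(j := x i)) * g' x"] allI eq
        mpolys_add mpolys_mult mpolys_fun_upd_var fg mult.hyps assms(2))
qed

text \<open>
  The factors are split off one at a time. That the quotient still vanishes on the remaining
  hyperplanes holds because the factors split off so far do not vanish identically on them.
\<close>

lemma mpolys_factor_differences:
  assumes "finite S" "\<And>i j. (i, j) \<in> S \<Longrightarrow> i < j \<and> j < m"
    and "f \<in> mpolys m" "\<And>i j x. (i, j) \<in> S \<Longrightarrow> x i = x j \<Longrightarrow> f x = 0"
  shows "\<exists>g\<in>mpolys m. \<forall>x. f x = (\<Prod>(i, j)\<in>S. x j - x i) * g x"
  using assms(1,2,4)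
proof (induction S rule: finite_induct)
  case empty
  then show ?case using assms(3) by auto
next
  case (insert s S)
  obtain k l where s: "s = (k, l)" by (cases s)
  have kl: "k < l" "l < m" using insert.prems(1)[of k l] s by auto
  have "\<exists>g\<in>mpolys m. \<forall>x. f x = (\<Prod>(i, j)\<in>S. x j - x i) * g x"
  proof (rule insert.IH)
    show "i < j \<and> j < m" if "(i, j) \<in> S" for i j using insert.prems(1)[of i j] that by simp
    show "f x = 0" if "(i, j) \<in> S" "x i = x j" for i j x
      using insert.prems(2)[of i j x] that by simp
  qed
  then obtain g where g: "g \<in> mpolys m" "\<And>x. f x = (\<Prod>(i, j)\<in>S. x j - x i) * g x" by blast
  have g0: "g (x(l := x k)) = 0" for x
  proof -
    let ?h = "\<lambda>x :: nat \<Rightarrow> complex. \<Prod>(i, j)\<in>S. (x(l := x k)) j - (x(l := x k)) i"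
    let ?f = "\<lambda>x. g (x(l := x k))"
    show ?thesis
    proof (rule mpolys_mult_eq_0[of ?f m ?h])
      show "?f \<in> mpolys m" using g(1) kl by (intro mpolys_fun_upd_var) auto
      have "(\<lambda>x. \<Prod>(i, j)\<in>S. x j - x i) \<in> mpolys m"
        using insert.prems(1) by (fastforce intro!: mpolys_intros simp: case_prod_beta)
      from mpolys_fun_upd_var[OF this, of k l]
      show "?h \<in> mpolys m" using kl by simp
      show "?f x * ?h x = 0" for x
        using g(2)[of "x(l := x k)"] insert.prems(2)[of k l "x(l := x k)"] kl s
        by (simp add: mult.commute)
      \<comment> \<open>At this point the only coincidence among the coordinates is the one of \<open>k\<close> and \<open>l\<close>.\<close>
      show "?h of_nat \<noteq> 0"
        using insert.hyps insert.prems(1) kl s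
        by (fastforce simp: prod_zero_iff split: if_splits)
    qed
  qed
  obtain g' where g': "g' \<in> mpolys m" "\<And>x. g x - g (x(l := x k)) = (x l - x k) * g' x"
    using mpolys_diff_diagonal[OF g(1), of k l] kl by auto
  have "f x = (\<Prod>(i, j)\<in>insert s S. x j - x i) * g' x" for x
    using insert.hyps g(2)[of x] g'(2)[of x] by (simp add: g0 s mult_ac)
  then show ?case using g'(1) by blast
qed

section \<open>Determinants\<close>

definition fun_det :: "nat \<Rightarrow> (nat \<Rightarrow> nat \<Rightarrow> complex) \<Rightarrow> complex" where
  "fun_det m F = det (mat m m (\<lambda>(i, j). F i j))"

lemma fun_det_cong:
  "(\<And>i j. i < m \<Longrightarrow> j < m \<Longrightarrow> F i j = G i j) \<Longrightarrow> fun_det m F = fun_det m G"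
  unfolding fun_det_def by (intro arg_cong[of _ _ det] eq_matI) auto

lemma fun_det_rows:
  "fun_det m F = (\<Sum>\<sigma> | \<sigma> permutes {..<m}. of_int (sign \<sigma>) * (\<Prod>i<m. F i (\<sigma> i)))"
proof -
  have "F i (\<sigma> i) = mat m m (\<lambda>(i, j). F i j) $$ (i, \<sigma> i)"
    if "\<sigma> permutes {..<m}" "i < m" for \<sigma> i
    using permutes_in_image[OF that(1), of i] that(2) by simp
  then show ?thesis
    unfolding fun_det_def by (subst det_def'[of _ m]) (auto simp: atLeast0LessThan intro!: sum.cong)
qed

lemma fun_det_transpose: "fun_det m (\<lambda>i j. F j i) = fun_det m F"
proof -
  have "mat m m (\<lambda>(i, j). F j i) = transpose_mat (mat m m (\<lambda>(i, j). F i j))"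
    by (intro eq_matI) auto
  then show ?thesis unfolding fun_det_def by (simp add: det_transpose[of _ m])
qed

lemma fun_det_cols:
  "fun_det m F = (\<Sum>\<sigma> | \<sigma> permutes {..<m}. of_int (sign \<sigma>) * (\<Prod>i<m. F (\<sigma> i) i))"
  using fun_det_rows[of m "\<lambda>i j. F j i"] fun_det_transpose[of m F] by simp

lemma fun_det_permute_rows:
  assumes "\<sigma> permutes {..<m}"
  shows "fun_det m (\<lambda>i j. F (\<sigma> i) j) = of_int (sign \<sigma>) * fun_det m F"
proof -
  have "mat m m (\<lambda>(i, j). mat m m (\<lambda>(i, j). F i j) $$ (\<sigma> i, j)) = mat m m (\<lambda>(i, j). F (\<sigma> i) j)"
    using permutes_in_image[OF assms] by (intro eq_matI) auto
  then show ?thesis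
    using det_permute_rows[of "mat m m (\<lambda>(i, j). F i j)" m \<sigma>] assms
    by (simp add: fun_det_def atLeast0LessThan)
qed

lemma fun_det_permute_cols:
  assumes "\<sigma> permutes {..<m}"
  shows "fun_det m (\<lambda>i j. F i (\<sigma> j)) = of_int (sign \<sigma>) * fun_det m F"
  using fun_det_permute_rows[OF assms, of "\<lambda>i j. F j i"]
    fun_det_transpose[of m "\<lambda>i j. F i (\<sigma> j)"] fun_det_transpose[of m F] by simp

lemma fun_det_eq_cols:
  assumes "i \<noteq> j" "i < m" "j < m" "\<And>k. k < m \<Longrightarrow> F k i = F k j"
  shows "fun_det m F = 0"
  unfolding fun_det_def
  by (rule det_identical_columns[of _ m i j]) (use assms in \<open>auto intro!: eq_vecI\<close>)

lemma fun_det_eq_rows: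
  assumes "i \<noteq> j" "i < m" "j < m" "\<And>k. k < m \<Longrightarrow> F i k = F j k"
  shows "fun_det m F = 0"
  using fun_det_eq_cols[of i j m "\<lambda>a b. F b a"] assms fun_det_transpose[of m F] by simp

lemma fun_det_mult_rows: "fun_det m (\<lambda>i j. c i * F i j) = (\<Prod>i<m. c i) * fun_det m F"
  by (simp add: fun_det_rows prod.distrib sum_distrib_left mult_ac)

lemma fun_det_mult_cols: "fun_det m (\<lambda>i j. c j * F i j) = (\<Prod>i<m. c i) * fun_det m F"
  by (simp add: fun_det_cols prod.distrib sum_distrib_left mult_ac)

lemma fun_det_scale:
  "fun_det m (\<lambda>i j. r i * (s j * F i j)) = (\<Prod>i<m. r i) * (\<Prod>j<m. s j) * fun_det m F"
  unfolding fun_det_mult_rows fun_det_mult_cols by (rule mult.assoc[symmetric])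

lemma fun_det_product:
  "fun_det m (\<lambda>i j. \<Sum>k<m. F i k * G k j) = fun_det m F * fun_det m G"
proof -
  have "mat m m (\<lambda>(i, j). \<Sum>k<m. F i k * G k j)
      = mat m m (\<lambda>(i, j). F i j) * mat m m (\<lambda>(i, j). G i j)"
    by (intro eq_matI) (auto simp: scalar_prod_def atLeast0LessThan)
  then show ?thesis unfolding fun_det_def by (simp add: det_mult[of _ m])
qed

lemma fun_det_lower_triangular:
  assumes "\<And>i j. i < j \<Longrightarrow> j < m \<Longrightarrow> F i j = 0"
  shows "fun_det m F = (\<Prod>i<m. F i i)"
proof -
  have "fun_det m F = prod_list (diag_mat (mat m m (\<lambda>(i, j). F i j)))"
    unfolding fun_det_def by (rule det_lower_triangular[of m]) (use assms in auto)
  also have "\<dots> = (\<Prod>i<m. F i i)"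
    by (auto simp: prod_list_diag_prod atLeast0LessThan)
  finally show ?thesis .
qed

lemma mpolys_fun_det:
  "(\<And>i j. i < m \<Longrightarrow> j < m \<Longrightarrow> (\<lambda>x. F x i j) \<in> mpolys M) \<Longrightarrow> (\<lambda>x. fun_det m (F x)) \<in> mpolys M"
  unfolding fun_det_rows by (intro mpolys_intros) (auto dest: permutes_in_image)

text \<open>
  Over the Newton basis \<open>\<Prod>l<k. (t - x l)\<close> in place of the monomials, the matrix becomes lower
  triangular, and the change of basis is unitriangular.
\<close>

lemma fun_det_vandermonde: "fun_det m (\<lambda>i k. x i ^ k) = vandermonde m x"
proof -
  define N where "N k = (\<Prod>l<k. [:- x l, 1:])" for k
  have N_deg: "degree (N k) = k" for k
    unfolding N_def by (subst degree_prod_sum_eq) auto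
  have N_lead: "coeff (N k) k = 1" for k
  proof -
    have "lead_coeff (N k) = 1" unfolding N_def by (simp add: lead_coeff_prod)
    then show ?thesis by (simp add: N_deg)
  qed
  have N_poly: "poly (N k) t = (\<Prod>l<k. t - x l)" for k t
    by (simp add: N_def poly_prod)
  have "fun_det m (\<lambda>i k. poly (N k) (x i)) = (\<Prod>i<m. poly (N i) (x i))"
    by (rule fun_det_lower_triangular) (auto simp: N_poly prod_zero_iff)
  moreover have "poly (N k) t = (\<Sum>j<m. t ^ j * coeff (N k) j)" if "k < m" for k t
    unfolding poly_altdef using that
    by (simp add: mult.commute) (intro sum.mono_neutral_left, auto simp: N_deg coeff_eq_0)
  then have "fun_det m (\<lambda>i k. poly (N k) (x i))
      = fun_det m (\<lambda>i k. \<Sum>j<m. x i ^ j * coeff (N k) j)"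
    by (intro fun_det_cong) auto
  moreover have "fun_det m (\<lambda>j k. coeff (N k) j) = 1"
    using fun_det_lower_triangular[of m "\<lambda>k j. coeff (N k) j"]
      fun_det_transpose[of m "\<lambda>k j. coeff (N k) j"] by (simp add: coeff_eq_0 N_deg N_lead)
  ultimately show ?thesis
    by (simp add: fun_det_product vandermonde_def N_poly)
qed

lemma vandermonde_permute:
  assumes "\<sigma> permutes {..<m}"
  shows "vandermonde m (x \<circ> \<sigma>) = of_int (sign \<sigma>) * vandermonde m x"
  using fun_det_permute_rows[OF assms, of "\<lambda>i k. x i ^ k"] by (simp flip: fun_det_vandermonde)

lemma mpolys_vandermonde:
  "(\<And>i. i < m \<Longrightarrow> g i \<in> mpolys M) \<Longrightarrow> (\<lambda>x. vandermonde m (\<lambda>i. g i x)) \<in> mpolys M"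
  unfolding vandermonde_def by (intro mpolys_intros) auto

lemma vandermonde_nonzero: "inj_on x {..<m} \<Longrightarrow> vandermonde m x \<noteq> 0"
  by (force simp: vandermonde_def prod_zero_iff inj_on_def)

text \<open>The Vandermonde product of points \<open>(a i : b i)\<close> of the projective line.\<close>

definition hom_vandermonde :: "nat \<Rightarrow> (nat \<Rightarrow> complex) \<Rightarrow> (nat \<Rightarrow> complex) \<Rightarrow> complex" where
  "hom_vandermonde m a b = (\<Prod>j<m. \<Prod>i<j. a i * b j - a j * b i)"

lemma prod_pairs: "(\<Prod>j<m. \<Prod>i<j. c i * c j) = (\<Prod>i<m. c i ^ (m - 1))"
  for c :: "nat \<Rightarrow> complex"
proof (induction m)
  case (Suc m)
  have "(\<Prod>i<m. c i ^ m) = (\<Prod>i<m. c i) * (\<Prod>i<m. c i ^ (m - 1))"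
    by (cases m) (simp_all add: prod.distrib)
  then show ?case using Suc by (simp add: prod.distrib mult_ac)
qed simp

text \<open>
  Where no \<open>a i\<close> vanishes, this is the Vandermonde determinant of the ratios \<open>b i / a i\<close> after scaling
  of the rows. Both sides are polynomials in \<open>a\<close>, so the restriction can be dropped.
\<close>

lemma fun_det_hom_vandermonde:
  "fun_det m (\<lambda>i k. a i ^ (m - 1 - k) * b i ^ k) = hom_vandermonde m a b"
proof -
  have "(\<lambda>a. fun_det m (\<lambda>i k. a i ^ (m - 1 - k) * b i ^ k)) = (\<lambda>a. hom_vandermonde m a b)"
  proof (rule mpolys_eqI_generic[of _ m _ "\<lambda>a. \<Prod>i<m. a i" "\<lambda>_. 1"])
    show "(\<lambda>a. fun_det m (\<lambda>i k. a i ^ (m - 1 - k) * b i ^ k)) \<in> mpolys m"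
      by (intro mpolys_fun_det mpolys_intros) auto
    show "(\<lambda>a. hom_vandermonde m a b) \<in> mpolys m"
      unfolding hom_vandermonde_def by (intro mpolys_intros) auto
    show "(\<lambda>a. \<Prod>i<m. a i) \<in> mpolys m"
      by (intro mpolys_intros) auto
  next
    fix a :: "nat \<Rightarrow> complex"
    assume "(\<Prod>i<m. a i) \<noteq> 0"
    then have a: "a i \<noteq> 0" if "i < m" for i
      using that by (auto simp: prod_zero_iff)
    have "fun_det m (\<lambda>i k. a i ^ (m - 1 - k) * b i ^ k)
        = fun_det m (\<lambda>i k. a i ^ (m - 1) * (b i / a i) ^ k)"
    proof (rule fun_det_cong)
      fix i k assume "i < m" "k < m"
      then have "a i ^ (m - 1) = a i ^ (m - 1 - k) * a i ^ k"
        by (simp flip: power_add)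
      then show "a i ^ (m - 1 - k) * b i ^ k = a i ^ (m - 1) * (b i / a i) ^ k"
        using a \<open>i < m\<close> by (simp add: power_divide)
    qed
    also have "\<dots> = (\<Prod>j<m. \<Prod>i<j. a i * a j) * vandermonde m (\<lambda>i. b i / a i)"
      by (simp add: fun_det_mult_rows fun_det_vandermonde prod_pairs)
    also have "\<dots> = hom_vandermonde m a b"
      unfolding hom_vandermonde_def vandermonde_def
      using a by (auto simp flip: prod.distrib simp: field_simps intro!: prod.cong)
    finally show "fun_det m (\<lambda>i k. a i ^ (m - 1 - k) * b i ^ k) = hom_vandermonde m a b" .
  qed simp
  then show ?thesis by (rule fun_cong)
qed

text \<open>
  Chio's condensation: multiples of the first row are subtracted so as to clear the first column, after
  the other rows have been scaled by the pivot \<open>F 0 0\<close> to avoid division. The scaled row operations are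
  multiplication by the lower triangular matrix \<open>E\<close>.
\<close>

lemma fun_det_condensation:
  "F 0 0 ^ m * fun_det (Suc m) F
     = F 0 0 * fun_det m (\<lambda>i j. F 0 0 * F (Suc i) (Suc j) - F (Suc i) 0 * F 0 (Suc j))"
proof -
  let ?G = "\<lambda>i j. F 0 0 * F (Suc i) (Suc j) - F (Suc i) 0 * F 0 (Suc j)"
  define E where "E i k = (if i = 0 then if k = 0 then 1 else 0
      else if k = 0 then - F i 0 else if k = i then F 0 0 else 0)" for i k
  have E: "fun_det (Suc m) E = F 0 0 ^ m"
    by (subst fun_det_lower_triangular) (auto simp: E_def lessThan_Suc_eq_insert_0 prod.reindex)
  have EF: "(\<Sum>k<Suc m. E i k * F k j)
      = (if i = 0 then F 0 j else F 0 0 * F i j - F i 0 * F 0 j)" if "i < Suc m" for i j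
  proof -
    have "(\<Sum>k<m. E i (Suc k) * F (Suc k) j)
        = (\<Sum>k<m. if Suc k = i then F 0 0 * F i j else 0)"
      by (intro sum.cong) (auto simp: E_def)
    also have "\<dots> = (if i = 0 then 0 else F 0 0 * F i j)"
    proof (cases i)
      case (Suc i')
      then show ?thesis using that by (simp add: sum.delta)
    qed simp
    finally show ?thesis
      by (simp add: sum.lessThan_Suc_shift del: sum.lessThan_Suc) (simp add: E_def)
  qed
  have "F 0 0 ^ m * fun_det (Suc m) F
      = fun_det (Suc m) (\<lambda>i j. if i = 0 then F 0 j else F 0 0 * F i j - F i 0 * F 0 j)"
    unfolding E[symmetric] fun_det_product[symmetric] by (rule fun_det_cong) (use EF in simp)
  also have "mat (Suc m) (Suc m)
        (\<lambda>(i, j). if i = 0 then F 0 j else F 0 0 * F i j - F i 0 * F 0 j)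
      = four_block_mat (mat 1 1 (\<lambda>_. F 0 0)) (mat 1 m (\<lambda>(i, j). F 0 (Suc j))) (0\<^sub>m m 1)
          (mat m m (\<lambda>(i, j). ?G i j))"
    by (intro eq_matI) (auto simp: four_block_mat_def)
  then have "fun_det (Suc m) (\<lambda>i j. if i = 0 then F 0 j else F 0 0 * F i j - F i 0 * F 0 j)
      = F 0 0 * fun_det m ?G"
    unfolding fun_det_def
    by (simp add: det_four_block_mat_lower_left_zero_col[of _ _ m] det_single)
  finally show ?thesis .
qed

section \<open>Pfaffians as alternating sums\<close>

definition alternating_sum :: "nat \<Rightarrow> ((nat \<Rightarrow> nat) \<Rightarrow> complex) \<Rightarrow> complex" where
  "alternating_sum N F = (\<Sum>\<sigma> | \<sigma> permutes {..<N}. of_int (sign \<sigma>) * F \<sigma>)"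

lemma alternating_sum_cong:
  "(\<And>\<sigma>. \<sigma> permutes {..<N} \<Longrightarrow> F \<sigma> = G \<sigma>) \<Longrightarrow> alternating_sum N F = alternating_sum N G"
  by (simp add: alternating_sum_def)

lemma alternating_sum_cmult: "alternating_sum N (\<lambda>\<sigma>. c * F \<sigma>) = c * alternating_sum N F"
  by (simp add: alternating_sum_def sum_distrib_left mult_ac)

lemma alternating_sum_diff:
  "alternating_sum N (\<lambda>\<sigma>. F \<sigma> - G \<sigma>) = alternating_sum N F - alternating_sum N G"
  by (simp add: alternating_sum_def sum_subtractf right_diff_distrib)

lemma alternating_sum_compose:
  assumes "\<tau> permutes {..<N}"
  shows "alternating_sum N (\<lambda>\<sigma>. F (\<sigma> \<circ> \<tau>)) = of_int (sign \<tau>) * alternating_sum N F"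
proof -
  have sign: "sign (\<sigma> \<circ> \<tau>) = sign \<sigma> * sign \<tau>" if "\<sigma> permutes {..<N}" for \<sigma>
    using that assms by (intro sign_compose permutes_imp_permutation) auto
  have "(of_int (sign \<tau>) * of_int (sign \<tau>) :: complex) = 1"
    by (simp flip: of_int_mult)
  then have "of_int (sign \<tau>) * (of_int (sign (\<sigma> \<circ> \<tau>)) * F (\<sigma> \<circ> \<tau>))
      = of_int (sign \<sigma>) * F (\<sigma> \<circ> \<tau>)" if "\<sigma> permutes {..<N}" for \<sigma>
    using that by (simp add: sign algebra_simps)
  then show ?thesis
    unfolding alternating_sum_def
      sum_permutations_compose_right[OF assms, of "\<lambda>\<sigma>. of_int (sign \<sigma>) * F \<sigma>"] sum_distrib_left
    by (intro sum.cong refl) (simp only: mem_Collect_eq)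
qed

text \<open>
  A partial alternation of \<open>H\<close>, over the permutations of some of the positions only, is absorbed by
  the full one, each of its terms contributing the same amount.
\<close>

lemma alternating_sum_absorb:
  assumes "inj_on f {..<m}" "f ` {..<m} \<subseteq> {..<N}"
    and G: "\<And>\<sigma> \<rho>. \<sigma> permutes {..<N} \<Longrightarrow> \<rho> permutes {..<m} \<Longrightarrow> G (\<sigma> \<circ> map_permutation {..<m} f \<rho>) = G \<sigma>"
  shows "alternating_sum N
           (\<lambda>\<sigma>. G \<sigma> * alternating_sum m (\<lambda>\<rho>. H (\<sigma> \<circ> map_permutation {..<m} f \<rho>)))
         = fact m * alternating_sum N (\<lambda>\<sigma>. G \<sigma> * H \<sigma>)"
proof -
  let ?l = "map_permutation {..<m} f"
  have "alternating_sum N (\<lambda>\<sigma>. G \<sigma> * alternating_sum m (\<lambda>\<rho>. H (\<sigma> \<circ> ?l \<rho>)))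
      = (\<Sum>\<sigma> | \<sigma> permutes {..<N}. \<Sum>\<rho> | \<rho> permutes {..<m}.
           of_int (sign \<rho>) * (of_int (sign \<sigma>) * (G (\<sigma> \<circ> ?l \<rho>) * H (\<sigma> \<circ> ?l \<rho>))))"
    by (simp add: alternating_sum_def sum_distrib_left G mult_ac)
  also have "\<dots> = (\<Sum>\<rho> | \<rho> permutes {..<m}.
      of_int (sign \<rho>) * alternating_sum N (\<lambda>\<sigma>. G (\<sigma> \<circ> ?l \<rho>) * H (\<sigma> \<circ> ?l \<rho>)))"
    by (subst sum.swap) (simp add: alternating_sum_def sum_distrib_left)
  also have "\<dots> = (\<Sum>\<rho> | \<rho> permutes {..<m}. alternating_sum N (\<lambda>\<sigma>. G \<sigma> * H \<sigma>))"
  proof (rule sum.cong[OF refl], clarify)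
    fix \<rho> assume \<rho>: "\<rho> permutes {..<m}"
    have "?l \<rho> permutes f ` {..<m}"
      using map_permutation_permutes[OF inj_on_imp_bij_betw[OF assms(1)] \<rho>] .
    then have "?l \<rho> permutes {..<N}" using assms(2) by (rule permutes_subset)
    moreover have "sign (?l \<rho>) = sign \<rho>"
      using sign_map_permutation[OF assms(1) \<rho>] by simp
    moreover have "(of_int (sign \<rho>) * of_int (sign \<rho>) :: complex) = 1"
      by (simp flip: of_int_mult)
    ultimately show "of_int (sign \<rho>) * alternating_sum N (\<lambda>\<sigma>. G (\<sigma> \<circ> ?l \<rho>) * H (\<sigma> \<circ> ?l \<rho>))
        = alternating_sum N (\<lambda>\<sigma>. G \<sigma> * H \<sigma>)"
      using alternating_sum_compose[of "?l \<rho>" N "\<lambda>\<sigma>. G \<sigma> * H \<sigma>"]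
      by (simp flip: mult.assoc)
  qed
  also have "\<dots> = fact m * alternating_sum N (\<lambda>\<sigma>. G \<sigma> * H \<sigma>)"
    by (simp add: card_permutations)
  finally show ?thesis .
qed

text \<open>
  Exchanging the two positions of a pair interchanges the two terms of the corresponding factor, with
  the sign of a transposition. Under the alternating sum both terms thus contribute the same, and the
  \<open>m\<close> factors produce the power \<open>2 ^ m\<close> of the normalization.
\<close>

lemma pfaffian_antisymmetrized:
  "pfaffian m (\<lambda>i j. x i j - x j i)
     = alternating_sum (2 * m) (\<lambda>\<sigma>. \<Prod>i<m. x (\<sigma> (2 * i)) (\<sigma> (Suc (2 * i)))) / fact m"
proof -
  let ?X = "\<lambda>\<sigma> i. x (\<sigma> (2 * i)) (\<sigma> (Suc (2 * i)))"
  let ?Y = "\<lambda>\<sigma> i. x (\<sigma> (Suc (2 * i))) (\<sigma> (2 * i))"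
  have "alternating_sum (2 * m) (\<lambda>\<sigma>. (\<Prod>i<k. ?X \<sigma> i - ?Y \<sigma> i) * (\<Prod>i\<in>{k..<m}. ?X \<sigma> i))
      = 2 ^ k * alternating_sum (2 * m) (\<lambda>\<sigma>. \<Prod>i<m. ?X \<sigma> i)" if "k \<le> m" for k
    using that
  proof (induction k)
    case 0
    then show ?case by (simp add: atLeast0LessThan)
  next
    case (Suc k)
    define R where "R \<sigma> = (\<Prod>i<k. ?X \<sigma> i - ?Y \<sigma> i) * (\<Prod>i\<in>{Suc k..<m}. ?X \<sigma> i)" for \<sigma>
    let ?t = "Transposition.transpose (2 * k) (Suc (2 * k))"
    have t: "?t permutes {..<2 * m}" using Suc.prems by (intro permutes_swap_id) auto
    have "2 * i \<noteq> Suc (2 * k)" "Suc (2 * i) \<noteq> 2 * k" for i :: nat by presburger+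
    then have other: "?X (\<sigma> \<circ> ?t) i = ?X \<sigma> i" "?Y (\<sigma> \<circ> ?t) i = ?Y \<sigma> i" if "i \<noteq> k" for \<sigma> i
      using that by (simp_all add: transpose_apply_other)
    have same: "?X (\<sigma> \<circ> ?t) k = ?Y \<sigma> k" for \<sigma> by simp
    have R: "R (\<sigma> \<circ> ?t) = R \<sigma>" for \<sigma>
      unfolding R_def by (intro arg_cong2[of _ _ _ _ "(*)"] prod.cong refl arg_cong2[of _ _ _ _ "(-)"] other) auto
    have split: "{k..<m} = insert k {Suc k..<m}" using Suc.prems by auto
    have "alternating_sum (2 * m) (\<lambda>\<sigma>. R \<sigma> * ?Y \<sigma> k)
        = - alternating_sum (2 * m) (\<lambda>\<sigma>. R \<sigma> * ?X \<sigma> k)"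
      using alternating_sum_compose[OF t, of "\<lambda>\<sigma>. R \<sigma> * ?X \<sigma> k"]
      by (simp only: R same) (simp add: sign_swap_id)
    then have "alternating_sum (2 * m) (\<lambda>\<sigma>. R \<sigma> * ?X \<sigma> k - R \<sigma> * ?Y \<sigma> k)
        = 2 * alternating_sum (2 * m) (\<lambda>\<sigma>. R \<sigma> * ?X \<sigma> k)"
      by (simp add: alternating_sum_diff)
    moreover have "(\<lambda>\<sigma>. R \<sigma> * ?X \<sigma> k) = (\<lambda>\<sigma>. (\<Prod>i<k. ?X \<sigma> i - ?Y \<sigma> i) * (\<Prod>i\<in>{k..<m}. ?X \<sigma> i))"
      by (simp add: R_def split mult_ac)
    moreover have "(\<lambda>\<sigma>. R \<sigma> * ?X \<sigma> k - R \<sigma> * ?Y \<sigma> k)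
        = (\<lambda>\<sigma>. (\<Prod>i<Suc k. ?X \<sigma> i - ?Y \<sigma> i) * (\<Prod>i\<in>{Suc k..<m}. ?X \<sigma> i))"
      by (simp add: R_def algebra_simps)
    ultimately show ?case using Suc.IH Suc.prems by (simp only: power_Suc mult.assoc)
  qed
  from this[of m] show ?thesis
    by (simp add: pfaffian_def alternating_sum_def)
qed

lemma map_permutation_even:
  fixes \<rho> :: "nat \<Rightarrow> nat"
  assumes "\<rho> permutes {..<m}" "i < m"
  shows "map_permutation {..<m} (\<lambda>i. 2 * i) \<rho> (2 * i) = 2 * \<rho> i"
    and "map_permutation {..<m} (\<lambda>i. 2 * i) \<rho> (Suc (2 * i)) = Suc (2 * i)"
proof -
  have inj: "inj_on (\<lambda>i::nat. 2 * i) {..<m}" by (simp add: inj_on_def)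
  show "map_permutation {..<m} (\<lambda>i. 2 * i) \<rho> (2 * i) = 2 * \<rho> i"
    using map_permutation_apply[OF inj, of i \<rho>] assms(2) by simp
  have "Suc (2 * i) \<notin> (\<lambda>i. 2 * i) ` {..<m}" by (auto; presburger)
  then show "map_permutation {..<m} (\<lambda>i. 2 * i) \<rho> (Suc (2 * i)) = Suc (2 * i)"
    by (rule permutes_not_in[OF map_permutation_permutes[OF inj_on_imp_bij_betw[OF inj] assms(1)]])
qed

lemma map_permutation_odd:
  fixes \<rho> :: "nat \<Rightarrow> nat"
  assumes "\<rho> permutes {..<m}" "i < m"
  shows "map_permutation {..<m} (\<lambda>i. Suc (2 * i)) \<rho> (Suc (2 * i)) = Suc (2 * \<rho> i)"
    and "map_permutation {..<m} (\<lambda>i. Suc (2 * i)) \<rho> (2 * i) = 2 * i"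
proof -
  have inj: "inj_on (\<lambda>i::nat. Suc (2 * i)) {..<m}" by (simp add: inj_on_def)
  show "map_permutation {..<m} (\<lambda>i. Suc (2 * i)) \<rho> (Suc (2 * i)) = Suc (2 * \<rho> i)"
    using map_permutation_apply[OF inj, of i \<rho>] assms(2) by simp
  have "2 * i \<notin> (\<lambda>i. Suc (2 * i)) ` {..<m}" by (auto; presburger)
  then show "map_permutation {..<m} (\<lambda>i. Suc (2 * i)) \<rho> (2 * i) = 2 * i"
    by (rule permutes_not_in[OF map_permutation_permutes[OF inj_on_imp_bij_betw[OF inj] assms(1)]])
qed

text \<open>
  Permutations of the odd positions preserve the product of the \<open>a\<close> and \<open>b\<close>, so the product of the \<open>c\<close>
  may be replaced by the average of its alternation over them, which is a determinant.
\<close>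

lemma alternating_sum_det_odd:
  "alternating_sum (2 * m)
     (\<lambda>\<sigma>. (\<Prod>i<m. a (\<sigma> (2 * i)) * b (\<sigma> (Suc (2 * i))))
          * fun_det m (\<lambda>i j. c (\<sigma> (2 * i)) (\<sigma> (Suc (2 * j)))))
   = fact m * alternating_sum (2 * m)
      (\<lambda>\<sigma>. \<Prod>i<m. a (\<sigma> (2 * i)) * b (\<sigma> (Suc (2 * i))) * c (\<sigma> (2 * i)) (\<sigma> (Suc (2 * i))))"
proof -
  let ?l = "map_permutation {..<m} (\<lambda>i. Suc (2 * i))"
  define G where "G \<sigma> = (\<Prod>i<m. a (\<sigma> (2 * i)) * b (\<sigma> (Suc (2 * i))))" for \<sigma> :: "nat \<Rightarrow> nat"
  define H where "H \<sigma> = (\<Prod>i<m. c (\<sigma> (2 * i)) (\<sigma> (Suc (2 * i))))" for \<sigma> :: "nat \<Rightarrow> nat"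
  have "fun_det m (\<lambda>i j. c (\<sigma> (2 * i)) (\<sigma> (Suc (2 * j)))) = alternating_sum m (\<lambda>\<rho>. H (\<sigma> \<circ> ?l \<rho>))" for \<sigma>
    unfolding fun_det_rows alternating_sum_def H_def
    using map_permutation_odd by (intro sum.cong refl arg_cong2[of _ _ _ _ "(*)"] prod.cong) auto
  moreover have "G (\<sigma> \<circ> ?l \<rho>) = G \<sigma>" if "\<rho> permutes {..<m}" for \<sigma> \<rho>
  proof -
    have "G (\<sigma> \<circ> ?l \<rho>) = (\<Prod>i<m. a (\<sigma> (2 * i))) * (\<Prod>i<m. b (\<sigma> (Suc (2 * \<rho> i))))"
      unfolding G_def using map_permutation_odd[OF that] by (simp add: prod.distrib)
    also have "(\<Prod>i<m. b (\<sigma> (Suc (2 * \<rho> i)))) = (\<Prod>i<m. b (\<sigma> (Suc (2 * i))))"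
      using prod.permute[OF that, of "\<lambda>i. b (\<sigma> (Suc (2 * i)))"] by (simp add: o_def)
    finally show ?thesis by (simp add: G_def prod.distrib)
  qed
  ultimately show ?thesis
    using alternating_sum_absorb[of "\<lambda>i. Suc (2 * i)" m "2 * m" G H]
    by (simp add: inj_on_def image_subset_iff G_def[symmetric]) (simp add: G_def H_def prod.distrib)
qed

lemma prod_even_odd: "(\<Prod>i<2 * m. f i) = (\<Prod>i<m. f (2 * i) * f (Suc (2 * i)))"
  for f :: "nat \<Rightarrow> complex"
  by (induction m) (simp_all add: mult_ac)

text \<open>
  The Laplace expansion of the Vandermonde determinant of \<open>2 m\<close> points along the columns with even and
  those with odd powers of \<open>b\<close>. The complementary minors are Vandermonde determinants in the squares,
  and each partition of the points into two halves occurs \<open>(m!)\<^sup>2\<close> times.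
\<close>

lemma alternating_sum_hom_vandermonde:
  "alternating_sum (2 * m)
     (\<lambda>\<sigma>. (\<Prod>i<m. a (\<sigma> (2 * i)) * b (\<sigma> (Suc (2 * i))))
          * hom_vandermonde m (\<lambda>i. a (\<sigma> (2 * i)) ^ 2) (\<lambda>i. b (\<sigma> (2 * i)) ^ 2)
          * hom_vandermonde m (\<lambda>i. a (\<sigma> (Suc (2 * i))) ^ 2) (\<lambda>i. b (\<sigma> (Suc (2 * i))) ^ 2))
   = fact m ^ 2 * hom_vandermonde (2 * m) a b"
proof -
  let ?e = "map_permutation {..<m} (\<lambda>i. 2 * i)"
  let ?o = "map_permutation {..<m} (\<lambda>i. Suc (2 * i))"
  define A where "A p k = (a p ^ 2) ^ (m - 1 - k) * (b p ^ 2) ^ k" for p k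
  define G where "G \<sigma> = (\<Prod>i<m. a (\<sigma> (2 * i)) * b (\<sigma> (Suc (2 * i))))" for \<sigma> :: "nat \<Rightarrow> nat"
  define E where "E \<sigma> = (\<Prod>i<m. A (\<sigma> (2 * i)) i)" for \<sigma> :: "nat \<Rightarrow> nat"
  define Od where "Od \<sigma> = (\<Prod>i<m. A (\<sigma> (Suc (2 * i))) i)" for \<sigma> :: "nat \<Rightarrow> nat"
  define D where "D \<sigma> = hom_vandermonde m (\<lambda>i. a (\<sigma> (Suc (2 * i))) ^ 2) (\<lambda>i. b (\<sigma> (Suc (2 * i))) ^ 2)"
    for \<sigma> :: "nat \<Rightarrow> nat"
  have even: "hom_vandermonde m (\<lambda>i. a (\<sigma> (2 * i)) ^ 2) (\<lambda>i. b (\<sigma> (2 * i)) ^ 2)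
      = alternating_sum m (\<lambda>\<rho>. E (\<sigma> \<circ> ?e \<rho>))" for \<sigma>
    unfolding fun_det_hom_vandermonde[symmetric] fun_det_cols alternating_sum_def E_def A_def
    using map_permutation_even by (intro sum.cong refl arg_cong2[of _ _ _ _ "(*)"] prod.cong) auto
  have odd: "D \<sigma> = alternating_sum m (\<lambda>\<rho>. Od (\<sigma> \<circ> ?o \<rho>))" for \<sigma>
    unfolding fun_det_hom_vandermonde[symmetric] fun_det_cols alternating_sum_def Od_def A_def D_def
    using map_permutation_odd by (intro sum.cong refl arg_cong2[of _ _ _ _ "(*)"] prod.cong) auto
  have Ge: "G (\<sigma> \<circ> ?e \<rho>) = G \<sigma>" if "\<rho> permutes {..<m}" for \<sigma> \<rho>
  proof -
    have "G (\<sigma> \<circ> ?e \<rho>) = (\<Prod>i<m. a (\<sigma> (2 * \<rho> i))) * (\<Prod>i<m. b (\<sigma> (Suc (2 * i))))"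
      unfolding G_def using map_permutation_even[OF that] by (simp add: prod.distrib)
    also have "(\<Prod>i<m. a (\<sigma> (2 * \<rho> i))) = (\<Prod>i<m. a (\<sigma> (2 * i)))"
      using prod.permute[OF that, of "\<lambda>i. a (\<sigma> (2 * i))"] by (simp add: o_def)
    finally show ?thesis by (simp add: G_def prod.distrib)
  qed
  have Go: "G (\<sigma> \<circ> ?o \<rho>) = G \<sigma>" if "\<rho> permutes {..<m}" for \<sigma> \<rho>
  proof -
    have "G (\<sigma> \<circ> ?o \<rho>) = (\<Prod>i<m. a (\<sigma> (2 * i))) * (\<Prod>i<m. b (\<sigma> (Suc (2 * \<rho> i))))"
      unfolding G_def using map_permutation_odd[OF that] by (simp add: prod.distrib)
    also have "(\<Prod>i<m. b (\<sigma> (Suc (2 * \<rho> i)))) = (\<Prod>i<m. b (\<sigma> (Suc (2 * i))))"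
      using prod.permute[OF that, of "\<lambda>i. b (\<sigma> (Suc (2 * i)))"] by (simp add: o_def)
    finally show ?thesis by (simp add: G_def prod.distrib)
  qed
  have De: "D (\<sigma> \<circ> ?e \<rho>) = D \<sigma>" if "\<rho> permutes {..<m}" for \<sigma> \<rho>
    unfolding D_def hom_vandermonde_def
    using map_permutation_even[OF that] by (intro prod.cong refl) simp
  have Eo: "E (\<sigma> \<circ> ?o \<rho>) = E \<sigma>" if "\<rho> permutes {..<m}" for \<sigma> \<rho>
    unfolding E_def using map_permutation_odd[OF that] by simp
  have "alternating_sum (2 * m) (\<lambda>\<sigma>. (G \<sigma> * D \<sigma>) * alternating_sum m (\<lambda>\<rho>. E (\<sigma> \<circ> ?e \<rho>)))
      = fact m * alternating_sum (2 * m) (\<lambda>\<sigma>. G \<sigma> * D \<sigma> * E \<sigma>)"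
    by (rule alternating_sum_absorb) (auto simp: inj_on_def Ge De)
  also have "alternating_sum (2 * m) (\<lambda>\<sigma>. G \<sigma> * D \<sigma> * E \<sigma>)
      = alternating_sum (2 * m) (\<lambda>\<sigma>. (G \<sigma> * E \<sigma>) * alternating_sum m (\<lambda>\<rho>. Od (\<sigma> \<circ> ?o \<rho>)))"
    by (simp add: odd mult_ac)
  also have "\<dots> = fact m * alternating_sum (2 * m) (\<lambda>\<sigma>. G \<sigma> * E \<sigma> * Od \<sigma>)"
    by (rule alternating_sum_absorb) (auto simp: inj_on_def Go Eo simp flip: Suc_eq_plus1)
  also have "alternating_sum (2 * m) (\<lambda>\<sigma>. G \<sigma> * E \<sigma> * Od \<sigma>) = hom_vandermonde (2 * m) a b"
  proof -
    have "G \<sigma> * E \<sigma> * Od \<sigma> = (\<Prod>i<2 * m. a (\<sigma> i) ^ (2 * m - 1 - i) * b (\<sigma> i) ^ i)" for \<sigma>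
      unfolding prod_even_odd G_def E_def Od_def prod.distrib[symmetric] A_def
    proof (intro prod.cong refl)
      fix i assume "i \<in> {..<m}"
      then have "2 * m - 1 - 2 * i = Suc (2 * (m - 1 - i))" "2 * m - 1 - (Suc (2 * i)) = 2 * (m - 1 - i)"
        by auto
      then show "a (\<sigma> (2 * i)) * b (\<sigma> (Suc (2 * i)))
          * ((a (\<sigma> (2 * i)))\<^sup>2 ^ (m - 1 - i) * (b (\<sigma> (2 * i)))\<^sup>2 ^ i)
          * ((a (\<sigma> (Suc (2 * i))))\<^sup>2 ^ (m - 1 - i) * (b (\<sigma> (Suc (2 * i))))\<^sup>2 ^ i)
        = a (\<sigma> (2 * i)) ^ (2 * m - 1 - 2 * i) * b (\<sigma> (2 * i)) ^ (2 * i)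
          * (a (\<sigma> (Suc (2 * i))) ^ (2 * m - 1 - (Suc (2 * i))) * b (\<sigma> (Suc (2 * i))) ^ (Suc (2 * i)))"
        by (simp only: power_mult[symmetric] power_Suc power_add) simp
    qed
    then show ?thesis
      by (simp add: alternating_sum_def fun_det_cols flip: fun_det_hom_vandermonde)
  qed
  finally show ?thesis
    unfolding even[symmetric] by (simp add: G_def D_def power2_eq_square mult_ac)
qed

text \<open>
  The determinants that pair the even with the odd positions of a rearrangement of the indices occur in
  the expansion of the Pfaffian. If each of them is, up to the common factor \<open>g\<close>, the same number \<open>k\<close>
  times the two Vandermonde products, then \<open>k\<close> factors out and leaves the preceding expansion.
\<close>

lemma pfaffian_eq_hom_vandermonde_mult:
  assumes sym: "\<And>i j. c i j = c j i"
    and det: "\<And>\<sigma>. \<sigma> permutes {..<2 * m} \<Longrightarrow>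
        g * fun_det m (\<lambda>i j. c (\<sigma> (2 * i)) (\<sigma> (Suc (2 * j))))
        = hom_vandermonde m (\<lambda>i. a (\<sigma> (2 * i)) ^ 2) (\<lambda>i. b (\<sigma> (2 * i)) ^ 2)
          * hom_vandermonde m (\<lambda>i. a (\<sigma> (Suc (2 * i))) ^ 2) (\<lambda>i. b (\<sigma> (Suc (2 * i))) ^ 2) * k"
  shows "g * pfaffian m (\<lambda>i j. (a i * b j - a j * b i) * c i j) = hom_vandermonde (2 * m) a b * k"
proof -
  let ?P = "\<lambda>\<sigma>. \<Prod>i<m. a (\<sigma> (2 * i)) * b (\<sigma> (Suc (2 * i)))"
  have "pfaffian m (\<lambda>i j. (a i * b j - a j * b i) * c i j)
      = pfaffian m (\<lambda>i j. a i * b j * c i j - a j * b i * c j i)"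
    using sym by (simp add: left_diff_distrib)
  also have "\<dots> = alternating_sum (2 * m) (\<lambda>\<sigma>. \<Prod>i<m.
      a (\<sigma> (2 * i)) * b (\<sigma> (Suc (2 * i))) * c (\<sigma> (2 * i)) (\<sigma> (Suc (2 * i)))) / fact m"
    by (rule pfaffian_antisymmetrized)
  also have "\<dots> = alternating_sum (2 * m)
      (\<lambda>\<sigma>. ?P \<sigma> * fun_det m (\<lambda>i j. c (\<sigma> (2 * i)) (\<sigma> (Suc (2 * j))))) / fact m ^ 2"
    by (simp add: alternating_sum_det_odd power2_eq_square)
  finally have "g * pfaffian m (\<lambda>i j. (a i * b j - a j * b i) * c i j)
      = alternating_sum (2 * m)
         (\<lambda>\<sigma>. ?P \<sigma> * (g * fun_det m (\<lambda>i j. c (\<sigma> (2 * i)) (\<sigma> (Suc (2 * j)))))) / fact m ^ 2"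
    by (simp add: alternating_sum_cmult[symmetric] mult_ac)
  also have "alternating_sum (2 * m)
         (\<lambda>\<sigma>. ?P \<sigma> * (g * fun_det m (\<lambda>i j. c (\<sigma> (2 * i)) (\<sigma> (Suc (2 * j))))))
      = alternating_sum (2 * m) (\<lambda>\<sigma>. k * (?P \<sigma>
          * hom_vandermonde m (\<lambda>i. a (\<sigma> (2 * i)) ^ 2) (\<lambda>i. b (\<sigma> (2 * i)) ^ 2)
          * hom_vandermonde m (\<lambda>i. a (\<sigma> (Suc (2 * i))) ^ 2) (\<lambda>i. b (\<sigma> (Suc (2 * i))) ^ 2)))"
    by (rule alternating_sum_cong) (simp only: det, simp only: mult_ac)
  finally show ?thesis
    unfolding alternating_sum_cmult alternating_sum_hom_vandermonde by simp
qed

section \<open>Orthogonal polynomials\<close>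

lemma polys_less_iff: "f \<in> polys_less n \<longleftrightarrow> (\<forall>i\<ge>n. coeff f i = 0)"
proof
  assume "\<forall>i\<ge>n. coeff f i = 0"
  then have "f \<noteq> 0 \<Longrightarrow> degree f < n"
    by (metis leading_coeff_0_iff not_le)
  then show "f \<in> polys_less n" by (auto simp: polys_less_def)
qed (auto simp: polys_less_def coeff_eq_0)

lemma polys_less_span:
  assumes "\<And>k. k < n \<Longrightarrow> degree (p k) = k \<and> coeff (p k) k = 1" "f \<in> polys_less n"
  shows "\<exists>c. f = (\<Sum>k<n. smult (c k) (p k))"
  using assms
proof (induction n arbitrary: f)
  case 0
  then show ?case by (auto simp: polys_less_def)
next
  case (Suc n)
  let ?g = "f - smult (coeff f n) (p n)"
  have "coeff (p n) i = (if i = n then 1 else 0)" if "i \<ge> n" for i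
    using Suc.prems(1)[of n] that by (auto simp: coeff_eq_0)
  then have "?g \<in> polys_less n"
    using Suc.prems(2) by (auto simp: polys_less_iff not_less_eq_eq[symmetric])
  with Suc obtain c where "?g = (\<Sum>k<n. smult (c k) (p k))" by fastforce
  then have "f = (\<Sum>k<Suc n. smult ((c(n := coeff f n)) k) (p k))"
    by (simp add: algebra_simps)
  then show ?case by blast
qed

fun gram_schmidt :: "(complex poly \<Rightarrow> complex) \<Rightarrow> nat \<Rightarrow> complex poly" where
  "gram_schmidt L k = monom 1 k - (\<Sum>j<k. smult
     (L (monom 1 k * gram_schmidt L j) / L (gram_schmidt L j * gram_schmidt L j)) (gram_schmidt L j))"

declare gram_schmidt.simps [simp del]

locale moment_functional =
  fixes L :: "complex poly \<Rightarrow> complex"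
  assumes linear: "Vector_Spaces.linear smult (*) L"
    and nondegenerate: "\<And>N. N \<ge> 1 \<Longrightarrow> nondegenerate_on L (polys_less N)"
begin

lemma module_hom_L: "module_hom smult (*) L"
  using linear by (simp add: Vector_Spaces.linear_def)

lemmas L_add = module_hom.add[OF module_hom_L]
  and L_diff = module_hom.diff[OF module_hom_L]
  and L_scale = module_hom.scale[OF module_hom_L]
  and L_sum = module_hom.sum[OF module_hom_L]

declare L_scale [simp]

lemma L_mult_sum: "L (f * (\<Sum>k\<in>A. g k)) = (\<Sum>k\<in>A. L (f * g k))"
  "L ((\<Sum>k\<in>A. g k) * f) = (\<Sum>k\<in>A. L (g k * f))"
  by (simp_all add: sum_distrib_left sum_distrib_right L_sum)

lemma eq_0_if_orthogonal:
  assumes "f \<in> polys_less N" "\<And>g. g \<in> polys_less N \<Longrightarrow> L (f * g) = 0"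
  shows "f = 0"
proof (cases N)
  case 0
  then show ?thesis using assms(1) by (simp add: polys_less_def)
next
  case (Suc M)
  then show ?thesis using nondegenerate[of N] assms by (simp add: nondegenerate_on_def pairing_def)
qed

definition is_monic_orthogonal :: "(nat \<Rightarrow> complex poly) \<Rightarrow> bool" where
  "is_monic_orthogonal p \<longleftrightarrow> (\<forall>k. degree (p k) = k \<and> lead_coeff (p k) = 1) \<and>
     (\<forall>j k. j \<noteq> k \<longrightarrow> pairing L (p j) (p k) = 0)"

text \<open>
  Non-degeneracy is what keeps the process going: a monic polynomial of degree \<open>k\<close> that is orthogonal
  to its predecessors and to itself is orthogonal to all polynomials of degree at most \<open>k\<close>, hence zero.
\<close>

lemma gram_schmidt_step:
  "degree (gram_schmidt L k) = k \<and> coeff (gram_schmidt L k) k = 1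
   \<and> (\<forall>j<k. L (gram_schmidt L k * gram_schmidt L j) = 0)
   \<and> L (gram_schmidt L k * gram_schmidt L k) \<noteq> 0"
proof (induction k rule: less_induct)
  case (less k)
  let ?g = "gram_schmidt L"
  define S where "S = (\<Sum>j<k. smult (L (monom 1 k * ?g j) / L (?g j * ?g j)) (?g j))"
  have gk: "?g k = monom 1 k - S" unfolding S_def by (rule gram_schmidt.simps)
  have "coeff S i = 0" if "i \<ge> k" for i
    unfolding S_def using less that by (auto simp: coeff_sum coeff_eq_0 intro!: sum.neutral)
  then have coeff: "coeff (?g k) i = (if i = k then 1 else 0)" if "i \<ge> k" for i
    using that by (simp add: gk)
  then have deg: "degree (?g k) = k"
    by (intro antisym degree_le le_degree) auto
  have orth: "L (?g k * ?g i) = 0" if "i < k" for i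
  proof -
    have "L (?g j * ?g i) = 0" if "j < k" "j \<noteq> i" for j
      using less[of i] less[of j] that \<open>i < k\<close> by (metis linorder_neqE_nat mult.commute)
    then have "L (S * ?g i) = (\<Sum>j<k. if j = i then L (monom 1 k * ?g i) else 0)"
      unfolding S_def L_mult_sum using less[of i] that by (intro sum.cong) auto
    also have "\<dots> = L (monom 1 k * ?g i)" using that by (simp add: sum.delta)
    finally show ?thesis by (simp add: gk left_diff_distrib L_diff)
  qed
  have "L (?g k * ?g k) \<noteq> 0"
  proof
    assume 0: "L (?g k * ?g k) = 0"
    have "?g k = 0"
    proof (rule eq_0_if_orthogonal[of _ "Suc k"])
      show "?g k \<in> polys_less (Suc k)" by (simp add: polys_less_def deg)
      fix f assume f: "f \<in> polys_less (Suc k)"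
      have basis: "degree (?g j) = j \<and> coeff (?g j) j = 1" if "j < Suc k" for j
        using less[of j] that deg coeff[of k] by (cases "j = k") auto
      obtain c where "f = (\<Sum>j<Suc k. smult (c j) (?g j))"
        using polys_less_span[OF basis f] by blast
      then show "L (?g k * f) = 0"
        using 0 orth by (simp add: distrib_left L_add L_mult_sum)
    qed
    then show False using coeff[of k] by simp
  qed
  then show ?case using deg coeff[of k] orth by simp
qed

lemma is_monic_orthogonal_gram_schmidt: "is_monic_orthogonal (gram_schmidt L)"
  unfolding is_monic_orthogonal_def pairing_def
  using gram_schmidt_step by (metis linorder_neqE_nat mult.commute)

lemma monic_orthogonal_less:
  assumes "is_monic_orthogonal p" "f \<in> polys_less k"
  shows "L (p k * f) = 0"
proof -
  obtain c where "f = (\<Sum>j<k. smult (c j) (p j))"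
    using polys_less_span[of k p f] assms by (metis is_monic_orthogonal_def)
  then show ?thesis
    using assms(1) by (auto simp: L_mult_sum is_monic_orthogonal_def pairing_def intro!: sum.neutral)
qed

lemma monic_orthogonal_unique:
  assumes "is_monic_orthogonal p" "is_monic_orthogonal q"
  shows "p = q"
proof
  fix k
  have "p k - q k = 0"
  proof (rule eq_0_if_orthogonal[of _ k])
    have "coeff (p k) i = coeff (q k) i" if "i \<ge> k" for i
      using assms that unfolding is_monic_orthogonal_def by (cases "i = k") (metis, simp add: coeff_eq_0)
    then show "p k - q k \<in> polys_less k" by (simp add: polys_less_iff)
    show "L ((p k - q k) * f) = 0" if "f \<in> polys_less k" for f
      using assms that by (simp add: left_diff_distrib L_diff monic_orthogonal_less)
  qed
  then show "p k = q k" by simp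
qed

abbreviation "p \<equiv> orth_polys L"
abbreviation "K \<equiv> cd_kernel L"

lemma orth_polys: "is_monic_orthogonal p"
proof -
  have "p = (THE p. is_monic_orthogonal p)"
    by (simp add: orth_polys_def is_monic_orthogonal_def)
  then show ?thesis
    using theI[of is_monic_orthogonal, OF is_monic_orthogonal_gram_schmidt]
      monic_orthogonal_unique is_monic_orthogonal_gram_schmidt by metis
qed

lemma degree_p: "degree (p k) = k" and coeff_p: "coeff (p k) k = 1"
  using orth_polys unfolding is_monic_orthogonal_def by metis+

lemma p_orthogonal: "j \<noteq> k \<Longrightarrow> L (p j * p k) = 0"
  using orth_polys unfolding is_monic_orthogonal_def pairing_def by metis

lemma p_norm_nonzero: "L (p k * p k) \<noteq> 0"
  using gram_schmidt_step[of k] monic_orthogonal_unique[OF orth_polys is_monic_orthogonal_gram_schmidt]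
  by simp

lemma p_span: "f \<in> polys_less n \<Longrightarrow> \<exists>c. f = (\<Sum>k<n. smult (c k) (p k))"
  by (rule polys_less_span) (simp_all add: degree_p coeff_p)

definition kernel_poly :: "nat \<Rightarrow> complex \<Rightarrow> complex poly" where
  "kernel_poly n x = (\<Sum>k<n. smult (poly (p k) x / L (p k * p k)) (p k))"

lemma poly_kernel_poly: "poly (kernel_poly n x) y = K n x y"
  by (simp add: kernel_poly_def cd_kernel_def poly_sum pairing_def)

lemma kernel_poly_less: "kernel_poly n x \<in> polys_less n"
  by (auto simp: polys_less_iff kernel_poly_def coeff_sum coeff_eq_0 degree_p intro!: sum.neutral)

lemma K_sym: "K n x y = K n y x"
  by (simp add: cd_kernel_def mult_ac)

lemma kernel_poly_reproducing:
  assumes "f \<in> polys_less n"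
  shows "L (f * kernel_poly n x) = poly f x"
proof -
  obtain c where f: "f = (\<Sum>k<n. smult (c k) (p k))"
    using p_span[OF assms] by blast
  have "L (p k * kernel_poly n x) = poly (p k) x" if "k < n" for k
  proof -
    have "L (p k * kernel_poly n x) = (\<Sum>j<n. if j = k then poly (p k) x else 0)"
      unfolding kernel_poly_def L_mult_sum
      using p_norm_nonzero by (intro sum.cong) (auto simp: p_orthogonal)
    then show ?thesis using that by simp
  qed
  then show ?thesis by (simp add: f L_mult_sum poly_sum)
qed

text \<open>
  For fixed \<open>x\<close>, the polynomial \<open>(t - x) K(x, t)\<close> is orthogonal to every \<open>g\<close> of degree below \<open>n\<close>, since
  integrating it against \<open>g\<close> amounts to evaluating \<open>(t - x) g(t)\<close> at \<open>t = x\<close>. It is therefore a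
  combination of the last two orthogonal polynomials. The coefficient of \<open>p (Suc n)\<close> is the leading
  one; antisymmetry under exchange of \<open>x\<close> and \<open>t\<close> gives the other.
\<close>

lemma christoffel_darboux:
  "(y - x) * K (Suc n) x y
     = (poly (p n) x * poly (p (Suc n)) y - poly (p (Suc n)) x * poly (p n) y) / L (p n * p n)"
proof -
  let ?h = "L (p n * p n)"
  have "\<exists>b. \<forall>t. (t - x) * K (Suc n) x t = poly (p n) x / ?h * poly (p (Suc n)) t + b * poly (p n) t" for x
  proof -
    let ?k = "kernel_poly (Suc n) x"
    let ?Q = "[:- x, 1:] * ?k"
    have k0: "coeff ?k i = 0" if "i > n" for i
      using kernel_poly_less[of "Suc n" x] that by (simp add: polys_less_iff)
    have kn: "coeff ?k n = poly (p n) x / ?h"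
      by (simp add: kernel_poly_def coeff_sum coeff_eq_0 degree_p coeff_p)
    \<comment> \<open>What remains after the leading term is a multiple of the \<open>n\<close>-th orthogonal polynomial.\<close>
    define R where "R = ?Q - smult (poly (p n) x / ?h) (p (Suc n))"
    have "coeff R i = 0" if "i \<ge> Suc n" for i
    proof (cases "i = Suc n")
      case True
      then show ?thesis using k0[of i] kn coeff_p[of "Suc n"] by (simp add: R_def)
    next
      case False
      then obtain i' where "i = Suc i'" "i' > n" using \<open>i \<ge> Suc n\<close> by (cases i) auto
      then show ?thesis using k0[of i] k0[of i'] by (simp add: R_def coeff_eq_0 degree_p)
    qed
    then have "R \<in> polys_less (Suc n)" by (simp add: polys_less_iff)
    then obtain c where R: "R = (\<Sum>k<Suc n. smult (c k) (p k))"
      using p_span by blast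
    have "c k = 0" if "k < n" for k
    proof -
      have "L (R * p k) = (\<Sum>j<Suc n. if j = k then c k * L (p k * p k) else 0)"
        unfolding R L_mult_sum by (intro sum.cong) (auto simp: p_orthogonal)
      then have "L (R * p k) = c k * L (p k * p k)"
        using that by (simp add: sum.delta)
      moreover have "L (?Q * p k) = L (([:- x, 1:] * p k) * ?k)" by (simp only: mult_ac)
      moreover have "[:- x, 1:] * p k \<in> polys_less (Suc n)"
        using that by (auto simp: polys_less_iff coeff_pCons coeff_eq_0 degree_p split: nat.splits)
      then have "L (([:- x, 1:] * p k) * ?k) = 0"
        by (subst kernel_poly_reproducing) auto
      ultimately show ?thesis
        using that p_norm_nonzero[of k] by (simp add: R_def left_diff_distrib L_diff p_orthogonal)
    qed
    then have "R = smult (c n) (p n)" by (simp add: R)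
    then have "?Q = smult (poly (p n) x / ?h) (p (Suc n)) + smult (c n) (p n)"
      by (simp add: R_def algebra_simps)
    then have "poly ?Q t = poly (p n) x / ?h * poly (p (Suc n)) t + c n * poly (p n) t" for t
      by simp
    then show ?thesis
      by (intro exI[of _ "c n"] allI) (simp add: poly_kernel_poly algebra_simps)
  qed
  then obtain b where b: "\<And>x t. (t - x) * K (Suc n) x t
      = poly (p n) x / ?h * poly (p (Suc n)) t + b x * poly (p n) t" by metis
  define g where "g x = b x + poly (p (Suc n)) x / ?h" for x
  have "(t - x) * K (Suc n) x t + (x - t) * K (Suc n) t x = 0" for x t
    by (simp add: K_sym[of _ t] algebra_simps)
  then have anti: "g x * poly (p n) t + g t * poly (p n) x = 0" for x t
    unfolding b g_def by (simp add: algebra_simps)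
  have "p n \<noteq> 0" using coeff_p[of n] by auto
  then obtain t where t: "poly (p n) t \<noteq> 0" using poly_all_0_iff_0 by blast
  have "g t = 0" using anti[of t t] t by simp
  then have "g x = 0" using anti[of x t] t by simp
  then have "b x = - poly (p (Suc n)) x / ?h" by (simp add: g_def eq_neg_iff_add_eq_0)
  then show ?thesis by (simp add: b diff_divide_distrib)
qed

end

section \<open>The reproducing kernel of antisymmetric polynomials\<close>

lemma antisym_polys_sum:
  assumes "\<And>s. s \<in> S \<Longrightarrow> f s \<in> antisym_polys m n"
  shows "(\<lambda>x. \<Sum>s\<in>S. c s * f s x) \<in> antisym_polys m n"
  using assms
  by (auto simp: antisym_polys_def sum_distrib_left mult.left_commute
      intro!: mpolys_less_sum mpolys_less_cmult sum.cong)

lemma tensor_squareI: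
  assumes "finite S" "\<And>s. s \<in> S \<Longrightarrow> f s \<in> V \<and> g s \<in> V"
  shows "(\<lambda>x y. \<Sum>s\<in>S. f s x * g s y) \<in> tensor_square V"
proof -
  obtain h where h: "bij_betw h {..<card S} S"
    using ex_bij_betw_nat_finite[OF assms(1)] by (auto simp: atLeast0LessThan)
  then have "(\<Sum>s\<in>S. f s x * g s y) = (\<Sum>i<card S. f (h i) x * g (h i) y)" for x y
    by (intro sum.reindex_bij_betw[symmetric])
  moreover have "\<forall>i<card S. f (h i) \<in> V \<and> g (h i) \<in> V"
    using h assms(2) by (auto simp: bij_betw_def)
  ultimately show ?thesis
    unfolding tensor_square_def
    by (intro CollectI exI[of _ "card S"] exI[of _ "\<lambda>i. f (h i)"] exI[of _ "\<lambda>i. g (h i)"]) auto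
qed

lemma tensor_square_antisym_slice:
  assumes "G \<in> tensor_square (antisym_polys m n)"
  shows "G x \<in> antisym_polys m n"
proof -
  obtain N :: nat and f g where fg: "\<And>i. i < N \<Longrightarrow> g i \<in> antisym_polys m n"
    and G: "G = (\<lambda>x y. \<Sum>i<N. f i x * g i y)"
    using assms by (auto simp: tensor_square_def)
  have "(\<lambda>y. \<Sum>i<N. f i x * g i y) \<in> antisym_polys m n"
    using fg by (intro antisym_polys_sum) simp
  then show ?thesis by (simp add: G)
qed

context moment_functional
begin

lemma integrate_var_sum:
  "integrate_var L m (\<lambda>y. \<Sum>s\<in>S. c s * (\<Prod>i<Suc m. poly (q s i) (y i)))
     = (\<lambda>y. \<Sum>s\<in>S. (c s * L (q s m)) * (\<Prod>i<m. poly (q s i) (y i)))"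
proof
  fix y
  define r where "r = (\<Sum>s\<in>S. smult (c s * (\<Prod>i<m. poly (q s i) (y i))) (q s m))"
  have eq: "(\<Sum>s\<in>S. c s * (\<Prod>i<Suc m. poly (q s i) ((y(m := t)) i))) = poly r t" for t
    by (simp add: r_def poly_sum mult.assoc)
  have "(THE q. \<forall>t. poly q t = poly r t) = r"
    by (rule the_equality) (auto simp: poly_eq_poly_eq_iff[symmetric])
  then show "integrate_var L m (\<lambda>y. \<Sum>s\<in>S. c s * (\<Prod>i<Suc m. poly (q s i) (y i))) y
      = (\<Sum>s\<in>S. (c s * L (q s m)) * (\<Prod>i<m. poly (q s i) (y i)))"
    unfolding integrate_var_def eq by (simp add: r_def L_sum mult_ac)
qed

lemma iterated_integral_sum:
  "iterated_integral L m (\<lambda>y. \<Sum>s\<in>S. c s * (\<Prod>i<m. poly (q s i) (y i)))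
     = (\<Sum>s\<in>S. c s * (\<Prod>i<m. L (q s i)))"
proof (induction m arbitrary: c)
  case (Suc m)
  show ?case
    unfolding iterated_integral.simps integrate_var_sum Suc by (simp add: mult_ac)
qed simp

definition K_det :: "nat \<Rightarrow> nat \<Rightarrow> (nat \<Rightarrow> complex) \<Rightarrow> (nat \<Rightarrow> complex) \<Rightarrow> complex" where
  "K_det n m x y = fun_det m (\<lambda>i j. K n (x i) (y j))"

lemma K_det_sym: "K_det n m x y = K_det n m y x"
proof -
  have "K_det n m x y = fun_det m (\<lambda>i j. K n (y j) (x i))"
    unfolding K_det_def by (rule fun_det_cong) (rule K_sym)
  also have "\<dots> = K_det n m y x"
    unfolding K_det_def by (rule fun_det_transpose)
  finally show ?thesis .
qed

text \<open>
  Each of the \<open>m!\<close> terms of the determinant reproduces \<open>f\<close> with permuted arguments, one variable at a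
  time, and antisymmetry cancels the sign of the term.
\<close>

lemma K_det_reproducing:
  assumes "f \<in> antisym_polys m n"
  shows "f x = mu_integral L m (\<lambda>y. f y * K_det n m x y)"
proof -
  let ?E = "{..<m} \<rightarrow>\<^sub>E {..<n}" and ?P = "{\<sigma>. \<sigma> permutes {..<m}}"
  obtain c where f: "f = (\<lambda>x. \<Sum>e\<in>?E. c e * (\<Prod>i<m. x i ^ e i))"
    and anti: "\<And>\<sigma> x. \<sigma> permutes {..<m} \<Longrightarrow> f (x \<circ> \<sigma>) = of_int (sign \<sigma>) * f x"
    using assms by (auto simp: antisym_polys_def mpolys_less_def)
  define q where "q s i = monom 1 (fst s i) * kernel_poly n (x (snd s i))"
    for s :: "(nat \<Rightarrow> nat) \<times> (nat \<Rightarrow> nat)" and i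
  have "f y * K_det n m x y = (\<Sum>s\<in>?E \<times> ?P. (c (fst s) * of_int (sign (snd s))) *
      (\<Prod>i<m. poly (q s i) (y i)))" for y
    unfolding f K_det_def fun_det_cols sum_product sum.cartesian_product
    by (intro sum.cong refl)
       (simp only: q_def case_prod_beta poly_mult poly_monom poly_kernel_poly prod.distrib mult_1 mult_ac)
  then have "iterated_integral L m (\<lambda>y. f y * K_det n m x y)
      = (\<Sum>s\<in>?E \<times> ?P. (c (fst s) * of_int (sign (snd s))) * (\<Prod>i<m. L (q s i)))"
    by (simp only: iterated_integral_sum)
  also have "\<dots> = (\<Sum>s\<in>?E \<times> ?P. (c (fst s) * of_int (sign (snd s))) * (\<Prod>i<m. x (snd s i) ^ fst s i))"
  proof -
    have "L (q s i) = x (snd s i) ^ fst s i" if "s \<in> ?E \<times> ?P" "i < m" for s i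
    proof -
      have "fst s \<in> ?E" using that(1) by (rule mem_Times_iff[THEN iffD1, THEN conjunct1])
      then have "fst s i < n" using that(2) by (auto simp: PiE_iff)
      then have "monom 1 (fst s i) \<in> polys_less n" by (simp add: polys_less_iff)
      from kernel_poly_reproducing[OF this, of "x (snd s i)"] show ?thesis
        by (simp add: q_def poly_monom)
    qed
    then have "(\<Prod>i<m. L (q s i)) = (\<Prod>i<m. x (snd s i) ^ fst s i)" if "s \<in> ?E \<times> ?P" for s
      using that by (intro prod.cong refl) blast
    then show ?thesis by (intro sum.cong refl) (simp only:)
  qed
  also have "\<dots> = (\<Sum>\<sigma>\<in>?P. of_int (sign \<sigma>) * f (x \<circ> \<sigma>))"
    unfolding f sum.cartesian_product' sum_distrib_left
    by (subst sum.swap) (simp add: mult_ac)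
  also have "\<dots> = (\<Sum>\<sigma>\<in>?P. f x)"
  proof (intro sum.cong refl)
    fix \<sigma> assume "\<sigma> \<in> ?P"
    moreover have "(of_int (sign \<sigma>) * of_int (sign \<sigma>) :: complex) = 1"
      by (simp flip: of_int_mult)
    ultimately show "of_int (sign \<sigma>) * f (x \<circ> \<sigma>) = f x"
      by (simp add: anti flip: mult.assoc)
  qed
  also have "\<dots> = fact m * f x" by (simp add: card_permutations)
  finally show ?thesis by (simp add: mu_integral_def)
qed

definition alternant :: "nat \<Rightarrow> (nat \<Rightarrow> nat) \<Rightarrow> (nat \<Rightarrow> complex) \<Rightarrow> complex" where
  "alternant m e x = fun_det m (\<lambda>i j. poly (p (e i)) (x j))"

lemma alternant_antisym:
  assumes "\<And>i. i < m \<Longrightarrow> e i < n"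
  shows "alternant m e \<in> antisym_polys m n"
proof -
  have "e (\<sigma> i) < n" if "\<sigma> permutes {..<m}" "i < m" for \<sigma> i
    using assms[of "\<sigma> i"] permutes_in_image[OF that(1), of i] that(2) by simp
  then have "(\<lambda>x. fun_det m (\<lambda>i j. poly (p (e i)) (x j))) \<in> mpolys_less m n"
    unfolding fun_det_cols
    by (intro mpolys_less_sum mpolys_less_cmult mpolys_less_prod_poly) (simp add: degree_p)
  then have "alternant m e \<in> mpolys_less m n" by (simp add: alternant_def[abs_def])
  moreover have "alternant m e (x \<circ> \<sigma>) = of_int (sign \<sigma>) * alternant m e x"
    if "\<sigma> permutes {..<m}" for \<sigma> x
    using fun_det_permute_cols[OF that, of "\<lambda>i j. poly (p (e i)) (x j)"] by (simp add: alternant_def)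
  ultimately show ?thesis by (simp add: antisym_polys_def)
qed

text \<open>
  Expanding the rows gives a sum of products of polynomials in \<open>x\<close> and alternants in \<open>y\<close>; averaging
  over the permutations of the rows makes the former antisymmetric too (the Cauchy--Binet formula).
\<close>

lemma K_det_in_tensor_square: "K_det n m \<in> tensor_square (antisym_polys m n)"
proof -
  let ?E = "{..<m} \<rightarrow>\<^sub>E {..<n}"
  define w where "w e = 1 / (\<Prod>i<m. L (p (e i) * p (e i)))" for e
  have expand: "K_det n m x y = (\<Sum>e\<in>?E. w e * (\<Prod>i<m. poly (p (e i)) (x i)) * alternant m e y)" for x y
  proof -
    have "(\<Prod>i<m. K n (x i) (y (\<sigma> i)))
        = (\<Sum>e\<in>?E. w e * (\<Prod>i<m. poly (p (e i)) (x i)) * (\<Prod>i<m. poly (p (e i)) (y (\<sigma> i))))" for \<sigma>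
      unfolding cd_kernel_def pairing_def
      by (simp add: prod_sum_PiE w_def prod.distrib prod_dividef)
    then show ?thesis
      unfolding K_det_def alternant_def fun_det_rows sum_distrib_left
      by (subst sum.swap) (simp add: sum_distrib_left mult_ac)
  qed
  have eq: "K_det n m x y = (\<Sum>e\<in>?E. (w e / fact m * alternant m e x) * alternant m e y)" for x y
  proof -
    have "fact m * K_det n m x y
        = (\<Sum>\<sigma> | \<sigma> permutes {..<m}. of_int (sign \<sigma>) * K_det n m (x \<circ> \<sigma>) y)"
    proof -
      have "of_int (sign \<sigma>) * K_det n m (x \<circ> \<sigma>) y = K_det n m x y" if "\<sigma> permutes {..<m}" for \<sigma>
      proof -
        have "(of_int (sign \<sigma>) * of_int (sign \<sigma>) :: complex) = 1"
          by (simp flip: of_int_mult)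
        then show ?thesis
          using fun_det_permute_rows[OF that, of "\<lambda>i j. K n (x i) (y j)"]
          by (simp add: K_det_def flip: mult.assoc)
      qed
      then show ?thesis by (simp add: card_permutations)
    qed
    also have "\<dots> = (\<Sum>e\<in>?E. w e * alternant m e x * alternant m e y)"
    proof -
      have "alternant m e x
          = (\<Sum>\<sigma> | \<sigma> permutes {..<m}. of_int (sign \<sigma>) * (\<Prod>i<m. poly (p (e i)) (x (\<sigma> i))))" for e
        by (simp add: alternant_def fun_det_rows)
      then show ?thesis
        unfolding expand sum_distrib_left
        by (subst sum.swap) (simp add: sum_distrib_left sum_distrib_right mult_ac)
    qed
    finally have "K_det n m x y = (\<Sum>e\<in>?E. w e * alternant m e x * alternant m e y) / fact m"
      by (simp add: eq_divide_eq mult.commute)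
    then show ?thesis by (simp add: sum_divide_distrib)
  qed
  have "(\<lambda>x y. \<Sum>e\<in>?E. (w e / fact m * alternant m e x) * alternant m e y)
      \<in> tensor_square (antisym_polys m n)"
  proof (rule tensor_squareI[of ?E "\<lambda>e x. w e / fact m * alternant m e x" _ "alternant m"])
    show "finite ?E" by (simp add: finite_PiE)
    fix e assume "e \<in> ?E"
    then have e: "alternant m e \<in> antisym_polys m n" by (intro alternant_antisym) auto
    then show "(\<lambda>x. w e / fact m * alternant m e x) \<in> antisym_polys m n \<and> alternant m e \<in> antisym_polys m n"
      using antisym_polys_sum[of "{()}" "\<lambda>_. alternant m e" m n "\<lambda>_. w e / fact m"] by simp
  qed
  then show ?thesis unfolding eq[symmetric] .
qed

text \<open>
  Two reproducing kernels agree because each slice of one is an antisymmetric polynomial, which the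
  other one reproduces.
\<close>

lemma reproducing_kernel_eq: "reproducing_kernel L n m = K_det n m"
  unfolding reproducing_kernel_def
proof (rule the_equality)
  show "K_det n m \<in> tensor_square (antisym_polys m n) \<and>
    (\<forall>f\<in>antisym_polys m n. \<forall>x. f x = mu_integral L m (\<lambda>y. f y * K_det n m x y))"
    by (intro conjI ballI allI K_det_in_tensor_square) (rule K_det_reproducing)
next
  fix G assume G: "G \<in> tensor_square (antisym_polys m n) \<and>
    (\<forall>f\<in>antisym_polys m n. \<forall>x. f x = mu_integral L m (\<lambda>y. f y * G x y))"
  have "G x y = K_det n m x y" for x y
  proof -
    have "G x y = mu_integral L m (\<lambda>y'. G x y' * K_det n m y y')"
      by (rule K_det_reproducing[of "G x" m n y])
         (rule tensor_square_antisym_slice[OF conjunct1[OF G]])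
    also have "\<dots> = mu_integral L m (\<lambda>y'. K_det n m y y' * G x y')"
      by (simp add: mult.commute)
    also have "\<dots> = K_det n m y x"
      using bspec[OF conjunct2[OF G], of "K_det n m y"]
        tensor_square_antisym_slice[OF K_det_in_tensor_square, of n m y]
      by (rule_tac spec[of _ x, THEN sym])
    finally show ?thesis by (simp add: K_det_sym[of n m y])
  qed
  then show "G = K_det n m" by blast
qed

section \<open>The multivariable Christoffel--Darboux kernel\<close>

lemma mpolys_K: "f \<in> mpolys M \<Longrightarrow> g \<in> mpolys M \<Longrightarrow> (\<lambda>z. K n (f z) (g z)) \<in> mpolys M"
  unfolding cd_kernel_def divide_inverse by (intro mpolys_intros mpolys_poly)

definition halves_vandermonde :: "nat \<Rightarrow> (nat \<Rightarrow> complex) \<Rightarrow> complex" where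
  "halves_vandermonde m z = vandermonde m z * vandermonde m (\<lambda>i. z (m + i))"

lemma mpolys_halves_vandermonde: "halves_vandermonde m \<in> mpolys (2 * m)"
  unfolding halves_vandermonde_def
  by (intro mpolys_mult mpolys_vandermonde mpolys_var) auto

lemma halves_vandermonde_of_nat: "halves_vandermonde m of_nat \<noteq> 0"
  by (auto simp: halves_vandermonde_def inj_on_def intro!: vandermonde_nonzero)

text \<open>
  The determinant has two equal rows or columns wherever one of the factors of the Vandermonde products
  vanishes.
\<close>

lemma mcd_kernel_exists:
  "\<exists>k\<in>mpolys (2 * m). \<forall>z. halves_vandermonde m z * k z = K_det n m z (\<lambda>i. z (m + i))"
proof -
  define T where "T = (SIGMA j:{..<m}. {..<j})"
  define S1 where "S1 = (\<lambda>(j, i). (i, j)) ` T"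
  define S2 where "S2 = (\<lambda>(j, i). (m + i, m + j)) ` T"
  have fin: "finite S1" "finite S2" by (auto simp: S1_def S2_def T_def)
  have "\<exists>g\<in>mpolys (2 * m). \<forall>z. K_det n m z (\<lambda>i. z (m + i)) = (\<Prod>(i, j)\<in>S1 \<union> S2. z j - z i) * g z"
  proof (rule mpolys_factor_differences)
    show "finite (S1 \<union> S2)" using fin by simp
    show "i < j \<and> j < 2 * m" if "(i, j) \<in> S1 \<union> S2" for i j
      using that by (auto simp: S1_def S2_def T_def)
    show "(\<lambda>z. K_det n m z (\<lambda>i. z (m + i))) \<in> mpolys (2 * m)"
      unfolding K_det_def by (intro mpolys_fun_det mpolys_K mpolys_var) auto
    show "K_det n m z (\<lambda>i. z (m + i)) = 0" if "(i, j) \<in> S1 \<union> S2" "z i = z j" for i j z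
    proof -
      have "i < j \<and> j < m \<or> (\<exists>i' j'. i = m + i' \<and> j = m + j' \<and> i' < j' \<and> j' < m)"
        using that(1) by (auto simp: S1_def S2_def T_def)
      then show ?thesis
      proof
        assume "i < j \<and> j < m"
        then show ?thesis
          unfolding K_det_def using that(2) by (intro fun_det_eq_rows[of i j]) auto
      next
        assume "\<exists>i' j'. i = m + i' \<and> j = m + j' \<and> i' < j' \<and> j' < m"
        then obtain i' j' where "i = m + i'" "j = m + j'" "i' < j'" "j' < m" by blast
        then show ?thesis
          unfolding K_det_def using that(2) by (intro fun_det_eq_cols[of i' j']) auto
      qed
    qed
  qed
  then obtain g where g: "g \<in> mpolys (2 * m)"
    "\<And>z. K_det n m z (\<lambda>i. z (m + i)) = (\<Prod>(i, j)\<in>S1 \<union> S2. z j - z i) * g z" by blast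
  have "(\<Prod>(i, j)\<in>S1 \<union> S2. z j - z i) = halves_vandermonde m z" for z :: "nat \<Rightarrow> complex"
  proof -
    have "(\<Prod>(i, j)\<in>S1. z j - z i) = vandermonde m z"
      unfolding S1_def T_def vandermonde_def
      by (subst prod.reindex) (auto simp: inj_on_def prod.Sigma case_prod_beta)
    moreover have "(\<Prod>(i, j)\<in>S2. z j - z i) = vandermonde m (\<lambda>i. z (m + i))"
      unfolding S2_def T_def vandermonde_def
      by (subst prod.reindex) (auto simp: inj_on_def prod.Sigma case_prod_beta)
    moreover have "S1 \<inter> S2 = {}" by (auto simp: S1_def S2_def T_def)
    ultimately show ?thesis
      using fin by (simp add: prod.union_disjoint halves_vandermonde_def)
  qed
  then show ?thesis using g by (intro bexI[of _ g]) auto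
qed

lemma mcd_kernel:
  "mcd_kernel L n m \<in> mpolys (2 * m) \<and>
   (\<forall>z. halves_vandermonde m z * mcd_kernel L n m z = K_det n m z (\<lambda>i. z (m + i)))"
proof -
  let ?P = "\<lambda>k. k \<in> mpolys (2 * m) \<and>
    (\<forall>z. halves_vandermonde m z * k z = K_det n m z (\<lambda>i. z (m + i)))"
  have "\<exists>!k. ?P k"
  proof (rule ex_ex1I)
    show "\<exists>k. ?P k" using mcd_kernel_exists by blast
    fix k k' assume k: "?P k" and k': "?P k'"
    show "k = k'"
    proof (rule mpolys_eqI_generic[of _ "2 * m" _ "halves_vandermonde m" of_nat])
      show "k z = k' z" if "halves_vandermonde m z \<noteq> 0" for z
        using k k' that by (metis mult_cancel_left)
    qed (use k k' mpolys_halves_vandermonde halves_vandermonde_of_nat in auto)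
  qed
  from theI'[OF this] show ?thesis
    by (simp add: mcd_kernel_def reproducing_kernel_eq halves_vandermonde_def)
qed

lemmas mpolys_mcd_kernel = mcd_kernel[THEN conjunct1]
  and mcd_kernel_eq = mcd_kernel[THEN conjunct2, rule_format]

text \<open>
  The symmetry of the kernel in the case of two pairs of variables: a Pluecker relation for the
  numerator of the Christoffel--Darboux formula, which is a determinant of order two.
\<close>

lemma K_exchange:
  "(K (Suc n) x y * K (Suc n) u v - K (Suc n) u y * K (Suc n) x v) * ((u - y) * (v - x))
   = (K (Suc n) y x * K (Suc n) u v - K (Suc n) u x * K (Suc n) y v) * ((u - x) * (v - y))"
proof -
  define Q where "Q t = poly (p (Suc n)) t" for t
  define R where "R t = poly (p n) t" for t
  define W where "W s t = (t - s) * K (Suc n) s t" for s t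
  define d where "d = inverse (L (p n * p n))"
  have W: "W s t = d * (R s * Q t - Q s * R t)" for s t
    by (simp add: W_def christoffel_darboux Q_def R_def d_def field_simps)
  have "(K (Suc n) x y * K (Suc n) u v - K (Suc n) u y * K (Suc n) x v) * ((u - y) * (v - x))
      - (K (Suc n) y x * K (Suc n) u v - K (Suc n) u x * K (Suc n) y v) * ((u - x) * (v - y))
      = - (W x y * W u v) + W u y * W x v - W u x * W y v"
    unfolding K_sym[of _ y x] W_def by (simp add: algebra_simps)
  also have "\<dots> = 0"
    unfolding W by (simp add: algebra_simps)
  finally show ?thesis by simp
qed

definition symmetric_under :: "((nat \<Rightarrow> complex) \<Rightarrow> complex) \<Rightarrow> (nat \<Rightarrow> nat) \<Rightarrow> bool" where
  "symmetric_under f \<pi> \<longleftrightarrow> (\<lambda>z. f (z \<circ> \<pi>)) = f"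

lemma symmetric_under_comp:
  "symmetric_under f \<pi> \<Longrightarrow> symmetric_under f \<rho> \<Longrightarrow> symmetric_under f (\<pi> \<circ> \<rho>)"
  by (simp add: symmetric_under_def fun_eq_iff flip: comp_assoc)

lemma mpolys_comp_permutation:
  assumes "f \<in> mpolys M" "\<pi> permutes {..<M}"
  shows "(\<lambda>z. f (z \<circ> \<pi>)) \<in> mpolys M"
proof -
  have "(\<lambda>z. z (\<pi> i)) \<in> mpolys M" if "i < M" for i
    using that permutes_in_image[OF assms(2), of i] by (intro mpolys_var) simp
  from mpolys_subst[OF assms(1) this] show ?thesis by (simp add: o_def)
qed

lemma mcd_kernel_symmetric_first_half:
  assumes "a < m" "b < m"
  shows "symmetric_under (mcd_kernel L n m) (Transposition.transpose a b)"
proof -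
  let ?t = "Transposition.transpose a b"
  have t: "?t permutes {..<m}" "?t permutes {..<2 * m}"
    using assms by (auto intro!: permutes_swap_id)
  show ?thesis
    unfolding symmetric_under_def
  proof (rule mpolys_eqI_generic[of _ "2 * m" _ "halves_vandermonde m" of_nat])
    fix z assume nz: "halves_vandermonde m z \<noteq> 0"
    have second: "(\<lambda>i. (z \<circ> ?t) (m + i)) = (\<lambda>i. z (m + i))"
      using assms by (auto simp: transpose_apply_other)
    have "of_int (sign ?t) * (halves_vandermonde m z * mcd_kernel L n m (z \<circ> ?t))
        = halves_vandermonde m (z \<circ> ?t) * mcd_kernel L n m (z \<circ> ?t)"
      unfolding halves_vandermonde_def second vandermonde_permute[OF t(1)] by simp
    also have "\<dots> = K_det n m (z \<circ> ?t) (\<lambda>i. z (m + i))"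
      by (simp only: mcd_kernel_eq second)
    also have "\<dots> = of_int (sign ?t) * K_det n m z (\<lambda>i. z (m + i))"
      using fun_det_permute_rows[OF t(1), of "\<lambda>i j. K n (z i) (z (m + j))"] by (simp add: K_det_def)
    also have "\<dots> = of_int (sign ?t) * (halves_vandermonde m z * mcd_kernel L n m z)"
      by (simp only: mcd_kernel_eq)
    finally show "mcd_kernel L n m (z \<circ> ?t) = mcd_kernel L n m z" using nz by simp
  qed (use mpolys_mcd_kernel mpolys_comp_permutation[OF mpolys_mcd_kernel t(2)]
      mpolys_halves_vandermonde halves_vandermonde_of_nat in auto)
qed

lemma mcd_kernel_symmetric_second_half:
  assumes "a < m" "b < m"
  shows "symmetric_under (mcd_kernel L n m) (Transposition.transpose (m + a) (m + b))"
proof -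
  let ?s = "Transposition.transpose a b" and ?t = "Transposition.transpose (m + a) (m + b)"
  have s: "?s permutes {..<m}" and t: "?t permutes {..<2 * m}"
    using assms by (auto intro!: permutes_swap_id)
  show ?thesis
    unfolding symmetric_under_def
  proof (rule mpolys_eqI_generic[of _ "2 * m" _ "halves_vandermonde m" of_nat])
    fix z assume nz: "halves_vandermonde m z \<noteq> 0"
    have first: "(z \<circ> ?t) i = z i" if "i < m" for i
      using that by (auto simp: transpose_apply_other)
    have second: "(\<lambda>i. (z \<circ> ?t) (m + i)) = (\<lambda>i. z (m + i)) \<circ> ?s"
      by (auto simp: Transposition.transpose_def)
    have first_vand: "vandermonde m (z \<circ> ?t) = vandermonde m z"
      unfolding vandermonde_def using first by (intro prod.cong refl) auto
    have "of_int (sign ?s) * (halves_vandermonde m z * mcd_kernel L n m (z \<circ> ?t))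
        = halves_vandermonde m (z \<circ> ?t) * mcd_kernel L n m (z \<circ> ?t)"
      unfolding halves_vandermonde_def second vandermonde_permute[OF s] first_vand by simp
    also have "\<dots> = K_det n m (z \<circ> ?t) ((\<lambda>i. z (m + i)) \<circ> ?s)"
      by (simp only: mcd_kernel_eq second)
    also have "\<dots> = K_det n m z ((\<lambda>i. z (m + i)) \<circ> ?s)"
      unfolding K_det_def by (rule fun_det_cong) (simp only: first)
    also have "\<dots> = of_int (sign ?s) * K_det n m z (\<lambda>i. z (m + i))"
      using fun_det_permute_cols[OF s, of "\<lambda>i j. K n (z i) (z (m + j))"] by (simp add: K_det_def)
    also have "\<dots> = of_int (sign ?s) * (halves_vandermonde m z * mcd_kernel L n m z)"
      by (simp only: mcd_kernel_eq)
    finally show "mcd_kernel L n m (z \<circ> ?t) = mcd_kernel L n m z" using nz by simp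
  qed (use mpolys_mcd_kernel mpolys_comp_permutation[OF mpolys_mcd_kernel t]
      mpolys_halves_vandermonde halves_vandermonde_of_nat in auto)
qed

lemma vandermonde_Suc_shift:
  "vandermonde (Suc m) x = (\<Prod>i<m. x (Suc i) - x 0) * vandermonde m (\<lambda>i. x (Suc i))"
  unfolding vandermonde_def
  by (simp add: prod.lessThan_Suc_shift prod.distrib del: prod.lessThan_Suc)

lemma K_nonzero: "\<exists>x y. K (Suc n) x y \<noteq> 0"
proof (rule ccontr)
  assume "\<not> ?thesis"
  then have "kernel_poly (Suc n) 0 = 0"
    by (simp add: poly_all_0_iff_0[symmetric] poly_kernel_poly)
  then show False
    using kernel_poly_reproducing[of 1 "Suc n" 0] by (simp add: polys_less_def module_hom.zero[OF module_hom_L])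
qed

text \<open>
  Condensing the determinant with pivot \<open>K (z 0) (z m)\<close> leaves a determinant of the minors of order
  two that contain the pivot. Their behaviour under the exchange of \<open>z 0\<close> and \<open>z m\<close> is known by
  \<open>K_exchange\<close>, and the factors appearing there are those of the Vandermonde products that involve
  \<open>z 0\<close> or \<open>z m\<close>.
\<close>

lemma mcd_kernel_symmetric_across:
  assumes "m > 0" "m \<le> n"
  shows "symmetric_under (mcd_kernel L n m) (Transposition.transpose 0 m)"
proof -
  obtain M where M: "m = Suc M" using assms by (cases m) auto
  obtain N where N: "n = Suc N" using assms by (cases n) auto
  let ?t = "Transposition.transpose 0 m"
  let ?V = "halves_vandermonde m"
  have t: "?t permutes {..<2 * m}" using assms by (auto intro!: permutes_swap_id)
  define h where "h z = (?V z * ?V (z \<circ> ?t)) * K n (z 0) (z m)" for z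
  have V: "?V \<in> mpolys (2 * m)" "(\<lambda>z. ?V (z \<circ> ?t)) \<in> mpolys (2 * m)"
    using mpolys_halves_vandermonde mpolys_comp_permutation[OF mpolys_halves_vandermonde t] by auto
  have Kp: "(\<lambda>z. K n (z 0) (z m)) \<in> mpolys (2 * m)"
    using assms by (intro mpolys_K mpolys_var) auto
  have h: "h \<in> mpolys (2 * m)"
    unfolding h_def by (intro mpolys_mult V Kp)
  have "\<exists>z0. h z0 \<noteq> 0"
  proof (rule ccontr)
    assume "\<not> ?thesis"
    then have 0: "(?V z * ?V (z \<circ> ?t)) * K n (z 0) (z m) = 0" for z by (simp add: h_def)
    obtain x y where "K n x y \<noteq> 0" using K_nonzero N by blast
    then have "?V z * ?V (z \<circ> ?t) = 0" for z
      by (intro mpolys_mult_eq_0[OF mpolys_mult[OF V] Kp 0, of "\<lambda>i. if i = 0 then x else y"])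
         (use assms in auto)
    moreover have "?V (of_nat \<circ> ?t) \<noteq> 0"
      by (auto simp: halves_vandermonde_def inj_on_def Transposition.transpose_def
          intro!: vandermonde_nonzero)
    ultimately show False using halves_vandermonde_of_nat by (metis mult_eq_0_iff)
  qed
  then obtain z0 where "h z0 \<noteq> 0" by blast
  have "mcd_kernel L n m (z \<circ> ?t) = mcd_kernel L n m z" if hz: "h z \<noteq> 0" for z
  proof -
    define \<kappa> where "\<kappa> = K n (z 0) (z m)"
    define u where "u = (\<lambda>i. z (Suc i))"
    define v where "v = (\<lambda>i. z (Suc (m + i)))"
    define A where "A = (\<lambda>i j. \<kappa> * K n (u i) (v j) - K n (u i) (z m) * K n (z 0) (v j))"
    define A' where "A' = (\<lambda>i j. \<kappa> * K n (u i) (v j) - K n (u i) (z 0) * K n (z m) (v j))"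
    define D where "D = (\<Prod>i<M. u i - z 0) * (\<Prod>i<M. v i - z m)"
    define D' where "D' = (\<Prod>i<M. u i - z m) * (\<Prod>i<M. v i - z 0)"
    define U where "U = vandermonde M u * vandermonde M v"
    have shift: "(z \<circ> ?t) (Suc i) = u i" "(z \<circ> ?t) (Suc (m + i)) = v i" if "i < M" for i
      using that by (auto simp: u_def v_def M Transposition.transpose_def)
    have V: "?V z = D * U"
      by (simp add: halves_vandermonde_def M vandermonde_Suc_shift D_def U_def u_def v_def mult_ac)
    have "vandermonde M (\<lambda>i. (z \<circ> ?t) (Suc i)) = vandermonde M u"
      "vandermonde M (\<lambda>i. (z \<circ> ?t) (Suc (m + i))) = vandermonde M v"
      unfolding vandermonde_def using shift by (auto intro!: prod.cong simp del: comp_apply)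
    moreover have "(\<Prod>i<M. (z \<circ> ?t) (Suc i) - (z \<circ> ?t) 0) = (\<Prod>i<M. u i - z m)"
      "(\<Prod>i<M. (z \<circ> ?t) (Suc (m + i)) - (z \<circ> ?t) m) = (\<Prod>i<M. v i - z 0)"
      using shift by (auto intro!: prod.cong)
    ultimately have V': "?V (z \<circ> ?t) = D' * U"
      unfolding halves_vandermonde_def D'_def U_def
      by (simp only: M vandermonde_Suc_shift add_Suc_right add_0_right mult_ac)
    have det: "\<kappa> ^ M * (?V z * mcd_kernel L n m z) = \<kappa> * fun_det M A"
      using fun_det_condensation[of "\<lambda>i j. K n (z i) (z (m + j))" M]
      by (simp add: mcd_kernel_eq K_det_def M \<kappa>_def A_def u_def v_def)
    have "fun_det M (\<lambda>i j. K n ((z \<circ> ?t) 0) ((z \<circ> ?t) (m + 0)) * K n ((z \<circ> ?t) (Suc i)) ((z \<circ> ?t) (m + Suc j))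
        - K n ((z \<circ> ?t) (Suc i)) ((z \<circ> ?t) (m + 0)) * K n ((z \<circ> ?t) 0) ((z \<circ> ?t) (m + Suc j)))
        = fun_det M A'"
      unfolding A'_def \<kappa>_def
      by (rule fun_det_cong) (simp add: shift K_sym[of n "z m" "z 0"] del: comp_apply, simp add: K_sym)
    then have det': "\<kappa> ^ M * (?V (z \<circ> ?t) * mcd_kernel L n m (z \<circ> ?t)) = \<kappa> * fun_det M A'"
      using fun_det_condensation[of "\<lambda>i j. K n ((z \<circ> ?t) i) ((z \<circ> ?t) (m + j))" M]
      unfolding mcd_kernel_eq K_det_def M[symmetric] by (simp add: \<kappa>_def K_sym[of n "z m" "z 0"])
    have exch: "D' * fun_det M A = D * fun_det M A'"
    proof -
      have "D' * fun_det M A = fun_det M (\<lambda>i j. (u i - z m) * ((v j - z 0) * A i j))"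
        unfolding fun_det_scale D'_def ..
      also have "\<dots> = fun_det M (\<lambda>i j. (u i - z 0) * ((v j - z m) * A' i j))"
        using K_exchange[of N "z 0" "z m"]
        by (intro fun_det_cong) (simp add: A_def A'_def \<kappa>_def N K_sym[of _ "z m" "z 0"] mult_ac)
      also have "\<dots> = D * fun_det M A'"
        unfolding fun_det_scale D_def ..
      finally show ?thesis .
    qed
    have "\<kappa> ^ M * ?V z * ?V (z \<circ> ?t) * mcd_kernel L n m z
        = (\<kappa> ^ M * (?V z * mcd_kernel L n m z)) * (D' * U)" by (simp add: V' mult_ac)
    also have "\<dots> = \<kappa> * U * (D' * fun_det M A)" unfolding det by (simp only: mult_ac)
    also have "\<dots> = \<kappa> * U * (D * fun_det M A')" by (simp only: exch)
    also have "\<dots> = (\<kappa> ^ M * (?V (z \<circ> ?t) * mcd_kernel L n m (z \<circ> ?t))) * (D * U)"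
      unfolding det' by (simp only: mult_ac)
    also have "\<dots> = \<kappa> ^ M * ?V z * ?V (z \<circ> ?t) * mcd_kernel L n m (z \<circ> ?t)"
      by (simp add: V mult_ac)
    finally show ?thesis
      using hz by (simp add: h_def \<kappa>_def)
  qed
  then show ?thesis
    unfolding symmetric_under_def
    using \<open>h z0 \<noteq> 0\<close> mpolys_mcd_kernel mpolys_comp_permutation[OF mpolys_mcd_kernel t] h
    by (intro mpolys_eqI_generic[of _ "2 * m" _ h z0]) auto
qed

lemma mcd_kernel_symmetric_transpose:
  assumes "m \<le> n" "a < 2 * m" "b < 2 * m"
  shows "symmetric_under (mcd_kernel L n m) (Transposition.transpose a b)"
proof -
  have *: "symmetric_under (mcd_kernel L n m) (Transposition.transpose a b)"
    if le: "a \<le> b" "b < 2 * m" for a b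
  proof -
    consider "b < m" | "a \<ge> m" | "a < m" "b \<ge> m" by linarith
    then show ?thesis
    proof cases
      case 1
      then show ?thesis using le by (intro mcd_kernel_symmetric_first_half) auto
    next
      case 2
      then show ?thesis
        using mcd_kernel_symmetric_second_half[of "a - m" m "b - m"] le by simp
    next
      case 3
      let ?A = "Transposition.transpose 0 a" and ?B = "Transposition.transpose m b"
        and ?C = "Transposition.transpose 0 m"
      have "symmetric_under (mcd_kernel L n m) ?A"
        using 3 by (intro mcd_kernel_symmetric_first_half) auto
      moreover have "symmetric_under (mcd_kernel L n m) ?B"
        using mcd_kernel_symmetric_second_half[of 0 m "b - m"] 3 le by simp
      moreover have "symmetric_under (mcd_kernel L n m) ?C"
        using 3 assms(1) by (intro mcd_kernel_symmetric_across) auto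
      ultimately have "symmetric_under (mcd_kernel L n m) (?A \<circ> (?B \<circ> ?C \<circ> ?B) \<circ> ?A)"
        by (intro symmetric_under_comp)
      moreover have "?B \<circ> ?C \<circ> ?B = Transposition.transpose 0 b"
        using 3 transpose_comp_triple[where a = b and b = m and c = 0] by (simp add: transpose_commute)
      moreover have "?A \<circ> Transposition.transpose 0 b \<circ> ?A = Transposition.transpose a b"
        using 3 transpose_comp_triple[where a = a and b = 0 and c = b] by (simp add: transpose_commute)
      ultimately show ?thesis by simp
    qed
  qed
  show ?thesis
    using *[of a b] *[of b a] assms(2,3) by (cases "a \<le> b") (simp_all add: transpose_commute)
qed

lemma mcd_kernel_symmetric:
  assumes "m \<le> n" "\<pi> permutes {..<2 * m}"
  shows "mcd_kernel L n m (z \<circ> \<pi>) = mcd_kernel L n m z"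
proof -
  have "symmetric_under (mcd_kernel L n m) \<pi>"
    using assms(2) finite_lessThan
  proof (induction rule: permutes_induct)
    case id
    show ?case by (simp add: symmetric_under_def comp_def)
  next
    case (swap a b \<tau>)
    then show ?case
      using mcd_kernel_symmetric_transpose[OF assms(1)] by (intro symmetric_under_comp) auto
  qed
  then show ?thesis unfolding symmetric_under_def by (rule fun_cong)
qed

lemma interleaving_permutes:
  "(\<lambda>i. if i < m then 2 * i else if i < 2 * m then Suc (2 * (i - m)) else i) permutes {..<2 * m}"
  (is "?\<pi> permutes _")
proof (rule bij_imp_permutes)
  have "inj_on ?\<pi> {..<2 * m}"
  proof (rule inj_onI)
    fix i j assume "i \<in> {..<2 * m}" "j \<in> {..<2 * m}" and eq: "?\<pi> i = ?\<pi> j"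
    moreover have "2 * i' \<noteq> Suc (2 * j')" "Suc (2 * j') \<noteq> 2 * i'" for i' j' :: nat by presburger+
    ultimately show "i = j" by (auto split: if_splits)
  qed
  moreover have "?\<pi> ` {..<2 * m} \<subseteq> {..<2 * m}" by auto
  ultimately show "bij_betw ?\<pi> {..<2 * m} {..<2 * m}"
    unfolding bij_betw_def using endo_inj_surj[OF finite_lessThan] by blast
qed auto

text \<open>
  Symmetry under the permutation that sorts the even positions before the odd ones turns the pairing
  of the first with the second half into the pairing of neighbours, which is that of the Pfaffian.
\<close>

lemma mcd_kernel_even_odd:
  assumes "m \<le> n" "\<sigma> permutes {..<2 * m}"
  shows "vandermonde m (\<lambda>i. z (\<sigma> (2 * i))) * vandermonde m (\<lambda>i. z (\<sigma> (Suc (2 * i)))) * mcd_kernel L n m z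
    = fun_det m (\<lambda>i j. K n (z (\<sigma> (2 * i))) (z (\<sigma> (Suc (2 * j)))))"
proof -
  define \<pi> where "\<pi> i = (if i < m then 2 * i else if i < 2 * m then Suc (2 * (i - m)) else i)" for i
  have "\<pi> permutes {..<2 * m}" unfolding \<pi>_def[abs_def] by (rule interleaving_permutes)
  then have "mcd_kernel L n m (z \<circ> (\<sigma> \<circ> \<pi>)) = mcd_kernel L n m z"
    using assms by (intro mcd_kernel_symmetric permutes_compose)
  moreover have "vandermonde m (z \<circ> (\<sigma> \<circ> \<pi>)) = vandermonde m (\<lambda>i. z (\<sigma> (2 * i)))"
    "vandermonde m (\<lambda>i. (z \<circ> (\<sigma> \<circ> \<pi>)) (m + i)) = vandermonde m (\<lambda>i. z (\<sigma> (Suc (2 * i))))"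
    unfolding vandermonde_def by (auto simp: \<pi>_def intro!: prod.cong)
  moreover have "K_det n m (z \<circ> (\<sigma> \<circ> \<pi>)) (\<lambda>i. (z \<circ> (\<sigma> \<circ> \<pi>)) (m + i))
      = fun_det m (\<lambda>i j. K n (z (\<sigma> (2 * i))) (z (\<sigma> (Suc (2 * j)))))"
    unfolding K_det_def by (rule fun_det_cong) (simp add: \<pi>_def)
  ultimately show ?thesis
    using mcd_kernel_eq[of m "z \<circ> (\<sigma> \<circ> \<pi>)" n] by (simp add: halves_vandermonde_def)
qed

section \<open>Pfaffian formulas\<close>

text \<open>
  The assumption makes the Vandermonde products of the points \<open>(a\<^sup>2 : b\<^sup>2)\<close> proportional to those of the
  \<open>z\<close>, each point \<open>i\<close> contributing its \<open>c i\<close> once for each of the \<open>m - 1\<close> others in its half.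
\<close>

lemma pfaffian_formula:
  assumes "m \<le> n"
    and sq: "\<And>i j. i < 2 * m \<Longrightarrow> j < 2 * m \<Longrightarrow>
      a i ^ 2 * b j ^ 2 - a j ^ 2 * b i ^ 2 = c i * c j * (z j - z i)"
  shows "(\<Prod>i<2 * m. c i ^ (m - 1)) * pfaffian m (\<lambda>i j. (a i * b j - a j * b i) * K n (z i) (z j))
    = hom_vandermonde (2 * m) a b * mcd_kernel L n m z"
proof (rule pfaffian_eq_hom_vandermonde_mult)
  show "K n (z i) (z j) = K n (z j) (z i)" for i j by (rule K_sym)
  fix \<sigma> assume \<sigma>: "\<sigma> permutes {..<2 * m}"
  have half: "hom_vandermonde m (\<lambda>i. a (\<tau> i) ^ 2) (\<lambda>i. b (\<tau> i) ^ 2)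
      = (\<Prod>i<m. c (\<tau> i) ^ (m - 1)) * vandermonde m (\<lambda>i. z (\<tau> i))"
    if "\<And>i. i < m \<Longrightarrow> \<tau> i < 2 * m" for \<tau>
    unfolding hom_vandermonde_def vandermonde_def prod_pairs[symmetric] prod.distrib[symmetric]
    using that by (intro prod.cong refl) (auto simp: sq)
  have in_range: "\<sigma> (2 * i) < 2 * m" "\<sigma> (Suc (2 * i)) < 2 * m" if "i < m" for i
    using permutes_in_image[OF \<sigma>] that by auto
  have "(\<Prod>i<2 * m. c i ^ (m - 1)) = (\<Prod>i<2 * m. c (\<sigma> i) ^ (m - 1))"
    using prod.permute[OF \<sigma>, of "\<lambda>i. c i ^ (m - 1)"] by (simp add: o_def)
  also have "\<dots> = (\<Prod>i<m. c (\<sigma> (2 * i)) ^ (m - 1)) * (\<Prod>i<m. c (\<sigma> (Suc (2 * i))) ^ (m - 1))"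
    by (simp add: prod_even_odd prod.distrib)
  finally have c: "(\<Prod>i<2 * m. c i ^ (m - 1))
      = (\<Prod>i<m. c (\<sigma> (2 * i)) ^ (m - 1)) * (\<Prod>i<m. c (\<sigma> (Suc (2 * i))) ^ (m - 1))" .
  have even: "hom_vandermonde m (\<lambda>i. a (\<sigma> (2 * i)) ^ 2) (\<lambda>i. b (\<sigma> (2 * i)) ^ 2)
      = (\<Prod>i<m. c (\<sigma> (2 * i)) ^ (m - 1)) * vandermonde m (\<lambda>i. z (\<sigma> (2 * i)))"
    by (rule half) (rule in_range)
  have odd: "hom_vandermonde m (\<lambda>i. a (\<sigma> (Suc (2 * i))) ^ 2) (\<lambda>i. b (\<sigma> (Suc (2 * i))) ^ 2)
      = (\<Prod>i<m. c (\<sigma> (Suc (2 * i))) ^ (m - 1)) * vandermonde m (\<lambda>i. z (\<sigma> (Suc (2 * i))))"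
    by (rule half) (rule in_range)
  show "(\<Prod>i<2 * m. c i ^ (m - 1)) *
      fun_det m (\<lambda>i j. K n (z (\<sigma> (2 * i))) (z (\<sigma> (Suc (2 * j)))))
    = hom_vandermonde m (\<lambda>i. a (\<sigma> (2 * i)) ^ 2) (\<lambda>i. b (\<sigma> (2 * i)) ^ 2)
      * hom_vandermonde m (\<lambda>i. a (\<sigma> (Suc (2 * i))) ^ 2) (\<lambda>i. b (\<sigma> (Suc (2 * i))) ^ 2)
      * mcd_kernel L n m z"
    unfolding c even odd mcd_kernel_even_odd[OF assms(1) \<sigma>, symmetric] by (simp only: mult_ac)
qed

end

theorem proposition3:
  fixes L :: "complex poly \<Rightarrow> complex" and m n :: nat and z :: "nat \<Rightarrow> complex"
  assumes linear: "Vector_Spaces.linear smult (*) L"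
    and nondegenerate: "\<And>N. N \<ge> 1 \<Longrightarrow> nondegenerate_on L (polys_less N)"
    and "m \<le> n"
  shows "(\<forall>w :: nat \<Rightarrow> complex.
            (\<forall>i<2 * m. w i ^ 2 = z i) \<longrightarrow>
            vandermonde (2 * m) w \<noteq> 0 \<longrightarrow>
            mcd_kernel L n m z
              = 1 / vandermonde (2 * m) w *
                pfaffian m (\<lambda>i j. (w j - w i) * cd_kernel L n (z i) (z j))) \<and>
         (\<forall>\<zeta> :: nat \<Rightarrow> complex.
            (\<forall>i<2 * m. \<zeta> i \<noteq> 0 \<and> \<zeta> i + inverse (\<zeta> i) = z i + 2) \<longrightarrow>
            vandermonde (2 * m) \<zeta> \<noteq> 0 \<longrightarrow>
            mcd_kernel L n m z
              = (\<Prod>i<2 * m. \<zeta> i powi (int m - 1)) / vandermonde (2 * m) \<zeta> *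
                pfaffian m (\<lambda>i j. (\<zeta> j - \<zeta> i) * cd_kernel L n (z i) (z j)))"
proof (intro conjI allI impI)
  interpret moment_functional L
    by (rule moment_functional.intro) (fact linear, fact nondegenerate)
  {
    fix w :: "nat \<Rightarrow> complex"
    assume w: "\<forall>i<2 * m. w i ^ 2 = z i" and nz: "vandermonde (2 * m) w \<noteq> 0"
    have "pfaffian m (\<lambda>i j. (w j - w i) * K n (z i) (z j)) = vandermonde (2 * m) w * mcd_kernel L n m z"
      using pfaffian_formula[OF \<open>m \<le> n\<close>, of "\<lambda>_. 1" w "\<lambda>_. 1" z] w
      by (simp add: hom_vandermonde_def vandermonde_def)
    then show "mcd_kernel L n m z = 1 / vandermonde (2 * m) w *
        pfaffian m (\<lambda>i j. (w j - w i) * K n (z i) (z j))"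
      using nz by simp
  next
    fix \<zeta> :: "nat \<Rightarrow> complex"
    assume \<zeta>: "\<forall>i<2 * m. \<zeta> i \<noteq> 0 \<and> \<zeta> i + inverse (\<zeta> i) = z i + 2"
      and nz: "vandermonde (2 * m) \<zeta> \<noteq> 0"
    \<comment> \<open>The squares of \<open>\<zeta> + 1\<close> and \<open>\<zeta> - 1\<close> are \<open>\<zeta> (z + 4)\<close> and \<open>\<zeta> z\<close>; the factor \<open>1 / 2\<close> normalizes the
      differences to \<open>\<zeta> j - \<zeta> i\<close>.\<close>
    let ?a = "\<lambda>i. (\<zeta> i + 1) / 2" and ?b = "\<lambda>i. \<zeta> i - 1"
    have ab: "?a i * ?b j - ?a j * ?b i = \<zeta> j - \<zeta> i" for i j
      by (simp add: field_simps)
    have "?a i ^ 2 * ?b j ^ 2 - ?a j ^ 2 * ?b i ^ 2 = \<zeta> i * \<zeta> j * (z j - z i)"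
      if "i < 2 * m" "j < 2 * m" for i j
    proof -
      have z: "\<zeta> k * z k = \<zeta> k ^ 2 + 1 - 2 * \<zeta> k" if "k < 2 * m" for k
      proof -
        have "z k = \<zeta> k + inverse (\<zeta> k) - 2" "\<zeta> k \<noteq> 0" using \<zeta> that by auto
        then show ?thesis by (simp add: field_simps power2_eq_square)
      qed
      have "\<zeta> i * \<zeta> j * (z j - z i) = \<zeta> i * (\<zeta> j * z j) - \<zeta> j * (\<zeta> i * z i)"
        by (simp add: algebra_simps)
      also have "\<dots> = \<zeta> i * (\<zeta> j ^ 2 + 1) - \<zeta> j * (\<zeta> i ^ 2 + 1)"
        unfolding z[OF that(1)] z[OF that(2)] by (simp add: algebra_simps)
      also have "\<dots> = ?a i ^ 2 * ?b j ^ 2 - ?a j ^ 2 * ?b i ^ 2"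
        by (simp add: field_simps power2_eq_square)
      finally show ?thesis ..
    qed
    from pfaffian_formula[OF \<open>m \<le> n\<close>, of ?a ?b \<zeta> z, OF this]
    have "(\<Prod>i<2 * m. \<zeta> i ^ (m - 1)) * pfaffian m (\<lambda>i j. (\<zeta> j - \<zeta> i) * K n (z i) (z j))
        = vandermonde (2 * m) \<zeta> * mcd_kernel L n m z"
      unfolding ab hom_vandermonde_def vandermonde_def by simp
    moreover have "(\<Prod>i<2 * m. \<zeta> i powi (int m - 1)) = (\<Prod>i<2 * m. \<zeta> i ^ (m - 1))"
      \<comment> \<open>The exponents differ for \<open>m = 0\<close>, where both products are empty.\<close>
      by (cases m) simp_all
    ultimately show "mcd_kernel L n m z = (\<Prod>i<2 * m. \<zeta> i powi (int m - 1)) / vandermonde (2 * m) \<zeta> *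
        pfaffian m (\<lambda>i j. (\<zeta> j - \<zeta> i) * K n (z i) (z j))"
      using nz by simp
  }
qed

end
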